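(* Let $n\ge1$, let $F\colon M\to N$ be a smooth map of manifolds, let $\varpi\in\Omega^{n+1}(F)$ be $d_F$-closed, and let $\mathfrak X(F)_\varpi:=\{v\in\mathfrak X(F):\mathcal L_v\varpi=0\}$ be the Lie algebra of $\varpi$-preserving $F$-pairs and $\mathfrak K(F,\varpi):=\{v\in\mathfrak X(F):\iota_v\varpi=0\}$. Then: (i) $\mathfrak K(F,\varpi)\subseteq\mathfrak X(F)_\varpi$; (ii) $\mathfrak K(F,\varpi)$ is an ideal of $\mathfrak X(F)_\varpi$; (iii) every multicontraction of $\varpi$ annihilates $\mathfrak K(F,\varpi)$: if one of the $F$-pairs $v_1,\dots,v_k$ lies in $\mathfrak K(F,\varpi)$, then $\iota(v_1\wedge\dots\wedge v_k)\varpi=0$.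
   Context: $\Omega^k(F)=\Omega^k(N)\oplus\Omega^{k-1}(M)$ with $d_F(\alpha,\beta)=(d\alpha,F^*\alpha-d\beta)$. An $F$-pair is $v=(v_N,v_M)$ with $v_N\in\mathfrak X(N)$, $v_M\in\mathfrak X(M)$, $dF\circ v_M=v_N\circ F$; $\mathfrak X(F)$ is the Lie algebra of $F$-pairs under the componentwise bracket. $\iota_v(\alpha,\beta)=(\iota_{v_N}\alpha,-\iota_{v_M}\beta)$, $\mathcal L_v(\alpha,\beta)=(\mathcal L_{v_N}\alpha,\mathcal L_{v_M}\beta)$, $\iota(v_1\wedge\dots\wedge v_k)=\iota_{v_k}\cdots\iota_{v_1}$. *)

theory Defs
  imports "HOL-Analysis.Analysis"
begin

section \<open>Smooth manifolds and smooth maps\<close>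

text \<open>For an open subset \<open>S\<close> of a finite-dimensional space this is the usual class \<open>C\<^sup>k\<close>: the
  condition on all directional derivatives is equivalent to the one on all partial derivatives.\<close>

fun Ck_on :: "nat \<Rightarrow> 'e set \<Rightarrow> ('e::real_normed_vector \<Rightarrow> 'f::real_normed_vector) \<Rightarrow> bool" where
  "Ck_on 0 S f \<longleftrightarrow> continuous_on S f"
| "Ck_on (Suc k) S f \<longleftrightarrow>
     (\<exists>f'. (\<forall>x\<in>S. (f has_derivative f' x) (at x)) \<and> (\<forall>v. Ck_on k S (\<lambda>x. f' x v)))"

definition smooth_on :: "'e set \<Rightarrow> ('e::real_normed_vector \<Rightarrow> 'f::real_normed_vector) \<Rightarrow> bool" where
  "smooth_on S f \<longleftrightarrow> (\<forall>k. Ck_on k S f)"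

text \<open>The model space is a finite-dimensional real inner product space. The class
  \<open>euclidean_space\<close> is not used because it would exclude manifolds of dimension 0. The carrier is
  the underlying set of an abstract topology, so it may be empty. A chart is a domain together with
  a map; the values of that map off the domain are irrelevant. The atlas need not be maximal.\<close>

record ('a, 'e) manifold =
  mtop :: "'a topology"
  atlas :: "('a set \<times> ('a \<Rightarrow> 'e)) set"

abbreviation pts :: "('a, 'e) manifold \<Rightarrow> 'a set" where
  "pts M \<equiv> topspace (mtop M)"

definition smooth_manifold :: "('a, 'e::real_inner) manifold \<Rightarrow> bool" where
  "smooth_manifold M \<longleftrightarrow>
     (\<exists>B::'e set. finite B \<and> span B = UNIV) \<and>
     Hausdorff_space (mtop M) \<and> second_countable (mtop M) \<and>
     (\<forall>(U, \<phi>)\<in>atlas M. openin (mtop M) U \<and> open (\<phi> ` U) \<and>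
        homeomorphic_map (subtopology (mtop M) U) (top_of_set (\<phi> ` U)) \<phi>) \<and>
     (\<Union>(U, \<phi>)\<in>atlas M. U) = pts M \<and>
     (\<forall>(U, \<phi>)\<in>atlas M. \<forall>(V, \<psi>)\<in>atlas M. smooth_on (\<phi> ` (U \<inter> V)) (\<psi> \<circ> inv_into U \<phi>))"

definition smooth_map ::
  "('a, 'e::real_inner) manifold \<Rightarrow> ('b, 'f::real_inner) manifold \<Rightarrow> ('a \<Rightarrow> 'b) \<Rightarrow> bool" where
  "smooth_map M N F \<longleftrightarrow>
     continuous_map (mtop M) (mtop N) F \<and>
     (\<forall>(U, \<phi>)\<in>atlas M. \<forall>(V, \<psi>)\<in>atlas N.
        smooth_on (\<phi> ` (U \<inter> F -` V)) (\<psi> \<circ> F \<circ> inv_into U \<phi>))"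

text \<open>The algebra of smooth real functions on \<open>M\<close>. Functions, tangent vectors, vector fields and
  forms are all extended by 0 outside their domain, so that equality on the domain is equality.\<close>

definition smooth_funs :: "('a, 'e::real_inner) manifold \<Rightarrow> ('a \<Rightarrow> real) set" where
  "smooth_funs M = {f. (\<forall>p. p \<notin> pts M \<longrightarrow> f p = 0) \<and>
     (\<forall>(U, \<phi>)\<in>atlas M. smooth_on (\<phi> ` U) (f \<circ> inv_into U \<phi>))}"


section \<open>Tangent vectors and vector fields\<close>

type_synonym 'a tangent = "('a \<Rightarrow> real) \<Rightarrow> real"
type_synonym 'a vfield = "'a \<Rightarrow> 'a tangent"

definition tangent_space :: "('a, 'e::real_inner) manifold \<Rightarrow> 'a \<Rightarrow> 'a tangent set" where
  "tangent_space M p = {D.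
     (\<forall>f. f \<notin> smooth_funs M \<longrightarrow> D f = 0) \<and>
     (\<forall>f\<in>smooth_funs M. \<forall>g\<in>smooth_funs M. \<forall>a b.
        D (\<lambda>x. a * f x + b * g x) = a * D f + b * D g) \<and>
     (\<forall>f\<in>smooth_funs M. \<forall>g\<in>smooth_funs M.
        D (\<lambda>x. f x * g x) = D f * g p + f p * D g)}"

definition vector_fields :: "('a, 'e::real_inner) manifold \<Rightarrow> 'a vfield set" where
  "vector_fields M = {X.
     (\<forall>p\<in>pts M. X p \<in> tangent_space M p) \<and>
     (\<forall>p. p \<notin> pts M \<longrightarrow> X p = (\<lambda>f. 0)) \<and>
     (\<forall>f\<in>smooth_funs M. (\<lambda>p. X p f) \<in> smooth_funs M)}"

definition vf_bracket :: "'a vfield \<Rightarrow> 'a vfield \<Rightarrow> 'a vfield" where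
  "vf_bracket X Y = (\<lambda>p f. X p (\<lambda>q. Y q f) - Y p (\<lambda>q. X q f))"

text \<open>The differential \<open>dF\<^sub>p\<close>; its formula does not mention \<open>p\<close>.\<close>

definition push_tangent ::
  "('a, 'e::real_inner) manifold \<Rightarrow> ('b, 'f::real_inner) manifold \<Rightarrow> ('a \<Rightarrow> 'b) \<Rightarrow>
   'a tangent \<Rightarrow> 'b tangent" where
  "push_tangent M N F D =
     (\<lambda>g. if g \<in> smooth_funs N then D (\<lambda>x. if x \<in> pts M then g (F x) else 0) else 0)"


section \<open>Differential forms\<close>

text \<open>\<open>\<alpha> p ws\<close> is the value of the form \<open>\<alpha>\<close> at the point \<open>p\<close> on the list \<open>ws\<close> of tangent vectors
  at \<open>p\<close>.\<close>

type_synonym 'a form = "'a \<Rightarrow> 'a tangent list \<Rightarrow> real"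

definition form_on :: "'a form \<Rightarrow> 'a vfield list \<Rightarrow> 'a \<Rightarrow> real" where
  "form_on \<alpha> Xs = (\<lambda>p. \<alpha> p (map (\<lambda>X. X p) Xs))"

definition forms :: "('a, 'e::real_inner) manifold \<Rightarrow> nat \<Rightarrow> 'a form set" where
  "forms M k = {\<alpha>.
     (\<forall>p ws. \<not> (p \<in> pts M \<and> length ws = k \<and> set ws \<subseteq> tangent_space M p) \<longrightarrow> \<alpha> p ws = 0) \<and>
     (\<forall>p\<in>pts M. \<forall>ws. length ws = k \<and> set ws \<subseteq> tangent_space M p \<longrightarrow>
        (\<forall>i<k. \<forall>u\<in>tangent_space M p. \<forall>v\<in>tangent_space M p. \<forall>a b.
           \<alpha> p (ws[i := (\<lambda>f. a * u f + b * v f)]) = a * \<alpha> p (ws[i := u]) + b * \<alpha> p (ws[i := v])) \<and>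
        (\<forall>j<k. \<forall>i<j. ws ! i = ws ! j \<longrightarrow> \<alpha> p ws = 0)) \<and>
     (\<forall>Xs. length Xs = k \<and> set Xs \<subseteq> vector_fields M \<longrightarrow> form_on \<alpha> Xs \<in> smooth_funs M)}"

definition zero_form :: "'a form" where
  "zero_form = (\<lambda>p ws. 0)"

text \<open>On forms of degree 0 the contraction is 0, since these vanish on nonempty lists.\<close>

definition contract :: "'a vfield \<Rightarrow> 'a form \<Rightarrow> 'a form" where
  "contract X \<alpha> = (\<lambda>p ws. \<alpha> p (X p # ws))"

definition pullback ::
  "('a, 'e::real_inner) manifold \<Rightarrow> ('b, 'f::real_inner) manifold \<Rightarrow> ('a \<Rightarrow> 'b) \<Rightarrow>
   'b form \<Rightarrow> 'a form" where
  "pullback M N F \<alpha> = (\<lambda>p ws. if p \<in> pts M \<and> set ws \<subseteq> tangent_space M p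
     then \<alpha> (F p) (map (push_tangent M N F) ws) else 0)"

text \<open>The exterior derivative and the Lie derivative are given by their invariant formulas
  \<open>d\<alpha>(X\<^sub>0,\<dots>,X\<^sub>k) = (\<Sum>i. (-1)\<^sup>i X\<^sub>i(\<alpha>(\<dots>,X\<^sub>i omitted,\<dots>)))
     + (\<Sum>i<j. (-1)\<^sup>i\<^sup>+\<^sup>j \<alpha>([X\<^sub>i,X\<^sub>j],\<dots>,X\<^sub>i and X\<^sub>j omitted,\<dots>))\<close> and
  \<open>(L\<^sub>X\<alpha>)(Y\<^sub>1,\<dots>,Y\<^sub>k) = X(\<alpha>(Y\<^sub>1,\<dots>,Y\<^sub>k)) - (\<Sum>i. \<alpha>(Y\<^sub>1,\<dots>,[X,Y\<^sub>i],\<dots>,Y\<^sub>k))\<close>.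
  To evaluate them on tangent vectors at \<open>p\<close>, these are extended to global vector fields; the
  right-hand sides are tensorial, so the values do not depend on the extensions.\<close>

definition extend_tangent :: "('a, 'e::real_inner) manifold \<Rightarrow> 'a \<Rightarrow> 'a tangent \<Rightarrow> 'a vfield" where
  "extend_tangent M p w = (SOME X. X \<in> vector_fields M \<and> X p = w)"

definition omit :: "nat \<Rightarrow> 'c list \<Rightarrow> 'c list" where
  "omit i xs = take i xs @ drop (Suc i) xs"

definition koszul :: "'a form \<Rightarrow> 'a vfield list \<Rightarrow> 'a \<Rightarrow> real" where
  "koszul \<alpha> Xs p =
     (\<Sum>i<length Xs. (- 1) ^ i * (Xs ! i) p (form_on \<alpha> (omit i Xs))) +
     (\<Sum>j<length Xs. \<Sum>i<j. (- 1) ^ (i + j) *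
        form_on \<alpha> (vf_bracket (Xs ! i) (Xs ! j) # omit i (omit j Xs)) p)"

definition ext_deriv :: "('a, 'e::real_inner) manifold \<Rightarrow> 'a form \<Rightarrow> 'a form" where
  "ext_deriv M \<alpha> = (\<lambda>p ws. if p \<in> pts M \<and> set ws \<subseteq> tangent_space M p
     then koszul \<alpha> (map (extend_tangent M p) ws) p else 0)"

definition lie_formula :: "'a vfield \<Rightarrow> 'a form \<Rightarrow> 'a vfield list \<Rightarrow> 'a \<Rightarrow> real" where
  "lie_formula X \<alpha> Ys p =
     X p (form_on \<alpha> Ys) - (\<Sum>i<length Ys. form_on \<alpha> (Ys[i := vf_bracket X (Ys ! i)]) p)"

definition lie_deriv :: "('a, 'e::real_inner) manifold \<Rightarrow> 'a vfield \<Rightarrow> 'a form \<Rightarrow> 'a form" where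
  "lie_deriv M X \<alpha> = (\<lambda>p ws. if p \<in> pts M \<and> set ws \<subseteq> tangent_space M p
     then lie_formula X \<alpha> (map (extend_tangent M p) ws) p else 0)"


section \<open>The relative complex of a map \<open>F: M \<rightarrow> N\<close>\<close>

text \<open>Elements are pairs with the component on the target \<open>N\<close> first.\<close>

type_synonym ('a, 'b) rel_form = "'b form \<times> 'a form"

definition rel_forms ::
  "('a, 'e::real_inner) manifold \<Rightarrow> ('b, 'f::real_inner) manifold \<Rightarrow> nat \<Rightarrow>
   ('a, 'b) rel_form set" where
  "rel_forms M N k = forms N k \<times> (case k of 0 \<Rightarrow> {zero_form} | Suc j \<Rightarrow> forms M j)"

definition rel_zero :: "('a, 'b) rel_form" where
  "rel_zero = (zero_form, zero_form)"

definition rel_deriv ::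
  "('a, 'e::real_inner) manifold \<Rightarrow> ('b, 'f::real_inner) manifold \<Rightarrow> ('a \<Rightarrow> 'b) \<Rightarrow>
   ('a, 'b) rel_form \<Rightarrow> ('a, 'b) rel_form" where
  "rel_deriv M N F = (\<lambda>(\<alpha>, \<beta>).
     (ext_deriv N \<alpha>, \<lambda>p ws. pullback M N F \<alpha> p ws - ext_deriv M \<beta> p ws))"

type_synonym ('a, 'b) fpair = "'b vfield \<times> 'a vfield"

definition fpairs ::
  "('a, 'e::real_inner) manifold \<Rightarrow> ('b, 'f::real_inner) manifold \<Rightarrow> ('a \<Rightarrow> 'b) \<Rightarrow>
   ('a, 'b) fpair set" where
  "fpairs M N F = {(Y, X). Y \<in> vector_fields N \<and> X \<in> vector_fields M \<and>
     (\<forall>p\<in>pts M. push_tangent M N F (X p) = Y (F p))}"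

definition fpair_zero :: "('a, 'b) fpair" where
  "fpair_zero = (\<lambda>q g. 0, \<lambda>p f. 0)"

definition fpair_add :: "('a, 'b) fpair \<Rightarrow> ('a, 'b) fpair \<Rightarrow> ('a, 'b) fpair" where
  "fpair_add v w = (\<lambda>q g. fst v q g + fst w q g, \<lambda>p f. snd v p f + snd w p f)"

definition fpair_scale :: "real \<Rightarrow> ('a, 'b) fpair \<Rightarrow> ('a, 'b) fpair" where
  "fpair_scale c v = (\<lambda>q g. c * fst v q g, \<lambda>p f. c * snd v p f)"

definition fpair_bracket :: "('a, 'b) fpair \<Rightarrow> ('a, 'b) fpair \<Rightarrow> ('a, 'b) fpair" where
  "fpair_bracket v w = (vf_bracket (fst v) (fst w), vf_bracket (snd v) (snd w))"

definition rel_contract :: "('a, 'b) fpair \<Rightarrow> ('a, 'b) rel_form \<Rightarrow> ('a, 'b) rel_form" where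
  "rel_contract v = (\<lambda>(\<alpha>, \<beta>). (contract (fst v) \<alpha>, \<lambda>p ws. - contract (snd v) \<beta> p ws))"

definition rel_lie ::
  "('a, 'e::real_inner) manifold \<Rightarrow> ('b, 'f::real_inner) manifold \<Rightarrow>
   ('a, 'b) fpair \<Rightarrow> ('a, 'b) rel_form \<Rightarrow> ('a, 'b) rel_form" where
  "rel_lie M N v = (\<lambda>(\<alpha>, \<beta>). (lie_deriv N (fst v) \<alpha>, lie_deriv M (snd v) \<beta>))"

text \<open>\<open>\<iota>(v\<^sub>1 \<and> \<dots> \<and> v\<^sub>k) = \<iota>(v\<^sub>k) \<dots> \<iota>(v\<^sub>1)\<close>: the head of the list is contracted first.\<close>

definition multicontract :: "('a, 'b) fpair list \<Rightarrow> ('a, 'b) rel_form \<Rightarrow> ('a, 'b) rel_form" where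
  "multicontract vs \<omega> = fold rel_contract vs \<omega>"

definition preserving_fpairs ::
  "('a, 'e::real_inner) manifold \<Rightarrow> ('b, 'f::real_inner) manifold \<Rightarrow> ('a \<Rightarrow> 'b) \<Rightarrow>
   ('a, 'b) rel_form \<Rightarrow> ('a, 'b) fpair set" where
  "preserving_fpairs M N F \<omega> = {v \<in> fpairs M N F. rel_lie M N v \<omega> = rel_zero}"

definition kernel_fpairs ::
  "('a, 'e::real_inner) manifold \<Rightarrow> ('b, 'f::real_inner) manifold \<Rightarrow> ('a \<Rightarrow> 'b) \<Rightarrow>
   ('a, 'b) rel_form \<Rightarrow> ('a, 'b) fpair set" where
  "kernel_fpairs M N F \<omega> = {v \<in> fpairs M N F. rel_contract v \<omega> = rel_zero}"

definition fpair_subspace :: "('a, 'b) fpair set \<Rightarrow> bool" where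
  "fpair_subspace S \<longleftrightarrow> fpair_zero \<in> S \<and>
     (\<forall>v\<in>S. \<forall>w\<in>S. fpair_add v w \<in> S) \<and> (\<forall>c. \<forall>v\<in>S. fpair_scale c v \<in> S)"

definition lie_subalgebra ::
  "('a, 'e::real_inner) manifold \<Rightarrow> ('b, 'f::real_inner) manifold \<Rightarrow> ('a \<Rightarrow> 'b) \<Rightarrow>
   ('a, 'b) fpair set \<Rightarrow> bool" where
  "lie_subalgebra M N F L \<longleftrightarrow> L \<subseteq> fpairs M N F \<and> fpair_subspace L \<and>
     (\<forall>v\<in>L. \<forall>w\<in>L. fpair_bracket v w \<in> L)"

definition lie_ideal ::
  "('a, 'e::real_inner) manifold \<Rightarrow> ('b, 'f::real_inner) manifold \<Rightarrow> ('a \<Rightarrow> 'b) \<Rightarrow>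
   ('a, 'b) fpair set \<Rightarrow> ('a, 'b) fpair set \<Rightarrow> bool" where
  "lie_ideal M N F I L \<longleftrightarrow> lie_subalgebra M N F L \<and> I \<subseteq> L \<and> fpair_subspace I \<and>
     (\<forall>v\<in>L. \<forall>w\<in>I. fpair_bracket v w \<in> I)"

end

theory Submission
  imports Defs
begin

text \<open>Write \<open>\<omega> = (\<alpha>, \<beta>)\<close>. The whole statement is Cartan calculus applied to \<open>\<alpha>\<close> on \<open>N\<close> and to \<open>\<beta>\<close> on \<open>M\<close>.
Let \<open>v = (Y, X)\<close> be an \<open>F\<close>-pair that contracts \<open>\<omega>\<close> to 0. In the Koszul formula for
\<open>d\<alpha>(Y, W\<^sub>1, \<dots>, W\<^sub>k)\<close> every term in which \<open>Y\<close> is an argument of \<open>\<alpha>\<close> drops out, and what is left is the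
formula for \<open>(L\<^sub>Y\<alpha>)(W\<^sub>1, \<dots>, W\<^sub>k)\<close> (\<open>koszul_eq_lie_formula\<close>). Since \<open>d\<alpha> = 0\<close>, this gives \<open>L\<^sub>Y\<alpha> = 0\<close>. On \<open>M\<close>,
closedness says \<open>d\<beta> = F\<^sup>*\<alpha>\<close>, so \<open>L\<^sub>X\<beta>\<close> is the contraction of \<open>F\<^sup>*\<alpha>\<close> with \<open>X\<close>; as \<open>X\<close> is \<open>F\<close>-related to
\<open>Y\<close>, this is the pullback of \<open>\<iota>\<^sub>Y\<alpha> = 0\<close> (\<open>kernel_subset_preserving\<close>). The ideal property comes from
\<open>(L\<^sub>X\<alpha>)(Y, \<dots>) = 0\<close>: if also \<open>\<iota>\<^sub>Y\<alpha> = 0\<close>, the only term that can survive is \<open>\<alpha>([X, Y], \<dots>)\<close>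
(\<open>contract_bracket\<close>). That the preserving pairs form a Lie algebra is \<open>L\<^bsub>[X,Y]\<^esub> = [L\<^sub>X, L\<^sub>Y]\<close>, that is, the
Jacobi identity (\<open>lie_formula_bracket\<close>). The last claim is alternation: a multicontraction inserts
the vectors into \<open>\<alpha>\<close> and \<open>\<beta>\<close>, and the annihilating vector can be moved to the front
(\<open>form_member_zero\<close>).

The substance lies in the passage between values at a point and global vector fields. The
derivatives \<open>d\<close> and \<open>L\<close> are evaluated on chosen global extensions of tangent vectors. One needs that
every tangent vector, a derivation of the algebra of smooth functions, has an extension, and that the
formulas do not depend on it. Both follow from one finite local frame (\<open>frame_at\<close>): near each point
there are functions \<open>\<rho>\<close>, \<open>h\<^sub>i\<close> and vector fields \<open>E\<^sub>i\<close> with \<open>\<rho>\<^sup>2 D f = (\<Sum>i. D(h\<^sub>i) E\<^sub>i f)\<close> for all tangent vectors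
\<open>D\<close> at all points. Constant coefficients give extensions (\<open>tangent_extends\<close>), and the coefficient
functions of a field that vanishes at \<open>p\<close> vanish at \<open>p\<close>, which gives independence
(\<open>tensorial_depends_on_value\<close>). The frame itself is Hadamard's lemma multiplied by the square of a bump function,
and so the development starts with the calculus of \<open>C\<^sup>k\<close> maps, bump functions and Hadamard's lemma.\<close>

section \<open>\<open>C\<^sup>k\<close> maps between inner product spaces\<close>

lemma Ck_on_subset: "Ck_on k S f \<Longrightarrow> T \<subseteq> S \<Longrightarrow> Ck_on k T f"
proof (induction k arbitrary: f)
  case 0 then show ?case by (auto intro: continuous_on_subset)
next
  case (Suc k) then show ?case by (simp, meson subsetD)
qed

lemma Ck_on_cong:
  assumes "open S" "\<And>x. x \<in> S \<Longrightarrow> f x = g x" "Ck_on k S f"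
  shows "Ck_on k S g"
proof (cases k)
  case 0 then show ?thesis using assms by (metis Ck_on.simps(1) continuous_on_cong)
next
  case (Suc l)
  then obtain f' where f': "\<forall>x\<in>S. (f has_derivative f' x) (at x)" "\<forall>v. Ck_on l S (\<lambda>x. f' x v)"
    using assms(3) by auto
  have "\<forall>x\<in>S. (g has_derivative f' x) (at x)"
    using f'(1) assms(1,2) by (meson has_derivative_transform_within_open)
  then show ?thesis using f'(2) Suc by auto
qed

lemma Ck_on_SucD: "Ck_on (Suc k) S f \<Longrightarrow> Ck_on k S f"
proof (induction k arbitrary: f)
  case 0
  then show ?case
    by (auto intro!: continuous_at_imp_continuous_on dest: has_derivative_continuous)
next
  case (Suc k)
  then obtain f' where f': "\<forall>x\<in>S. (f has_derivative f' x) (at x)" "\<forall>v. Ck_on (Suc k) S (\<lambda>x. f' x v)"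
    by (metis Ck_on.simps(2))
  then have "\<forall>v. Ck_on k S (\<lambda>x. f' x v)" using Suc.IH by blast
  with f'(1) show ?case by auto
qed

lemma Ck_on_const: "Ck_on k S (\<lambda>x. c)"
proof (induction k arbitrary: c)
  case (Suc k)
  then show ?case by (auto intro!: exI[of _ "\<lambda>x v. 0"])
qed simp

lemma Ck_on_add:
  "Ck_on k S f \<Longrightarrow> Ck_on k S g \<Longrightarrow> Ck_on k S (\<lambda>x. f x + g x)"
proof (induction k arbitrary: f g)
  case 0 then show ?case by (simp add: continuous_on_add)
next
  case (Suc k)
  then obtain f' g' where
    "\<forall>x\<in>S. (f has_derivative f' x) (at x)" "\<forall>v. Ck_on k S (\<lambda>x. f' x v)"
    "\<forall>x\<in>S. (g has_derivative g' x) (at x)" "\<forall>v. Ck_on k S (\<lambda>x. g' x v)" by auto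
  then show ?case
    using Suc.IH by (auto intro!: exI[of _ "\<lambda>x v. f' x v + g' x v"] has_derivative_add)
qed

lemma Ck_on_sum:
  "(\<And>i. i \<in> I \<Longrightarrow> Ck_on k S (f i)) \<Longrightarrow> Ck_on k S (\<lambda>x. \<Sum>i\<in>I. f i x)"
proof (induction I rule: infinite_finite_induct)
  case (insert i I)
  then show ?case by (simp add: Ck_on_add)
qed (simp_all add: Ck_on_const)

lemma Ck_on_bilinear:
  assumes "bounded_bilinear pr"
  shows "Ck_on k S f \<Longrightarrow> Ck_on k S g \<Longrightarrow> Ck_on k S (\<lambda>x. pr (f x) (g x))"
proof (induction k arbitrary: f g)
  case 0 then show ?case using bounded_bilinear.continuous_on[OF assms] by simp
next
  case (Suc k)
  then obtain f' g' where
    d: "\<forall>x\<in>S. (f has_derivative f' x) (at x)" "\<forall>v. Ck_on k S (\<lambda>x. f' x v)"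
    "\<forall>x\<in>S. (g has_derivative g' x) (at x)" "\<forall>v. Ck_on k S (\<lambda>x. g' x v)" by auto
  have "Ck_on k S f" "Ck_on k S g" using Suc.prems Ck_on_SucD by auto
  then have "\<forall>v. Ck_on k S (\<lambda>x. pr (f x) (g' x v) + pr (f' x v) (g x))"
    using d Suc.IH by (auto intro!: Ck_on_add)
  moreover have "\<forall>x\<in>S. ((\<lambda>x. pr (f x) (g x)) has_derivative
      (\<lambda>v. pr (f x) (g' x v) + pr (f' x v) (g x))) (at x)"
    using d by (auto intro!: bounded_bilinear.FDERIV[OF assms])
  ultimately show ?case by (auto intro!: exI[of _ "\<lambda>x v. pr (f x) (g' x v) + pr (f' x v) (g x)"])
qed

lemma Ck_on_linear:
  assumes "bounded_linear L"
  shows "Ck_on k S L"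
proof (cases k)
  case 0 then show ?thesis using assms by (simp add: linear_continuous_on)
next
  case (Suc l)
  then show ?thesis
    using assms by (auto intro!: exI[of _ "\<lambda>x. L"] Ck_on_const bounded_linear_imp_has_derivative)
qed

text \<open>On the overlap the two derivatives agree, because a derivative at an interior point is unique; hence
they glue.\<close>

lemma Ck_on_Un:
  assumes "open S" "open T"
  shows "Ck_on k S f \<Longrightarrow> Ck_on k T f \<Longrightarrow> Ck_on k (S \<union> T) f"
proof (induction k arbitrary: f)
  case 0 then show ?case using assms by (simp add: continuous_on_open_Un)
next
  case (Suc k)
  then obtain f' g' where
    d: "\<forall>x\<in>S. (f has_derivative f' x) (at x)" "\<forall>v. Ck_on k S (\<lambda>x. f' x v)"
    "\<forall>x\<in>T. (f has_derivative g' x) (at x)" "\<forall>v. Ck_on k T (\<lambda>x. g' x v)" by auto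
  define h where "h x = (if x \<in> S then f' x else g' x)" for x
  have "h x = g' x" if "x \<in> T" for x
    using d that unfolding h_def by (metis has_derivative_unique)
  then have "Ck_on k T (\<lambda>x. h x v)" for v
    using Ck_on_cong[OF assms(2), of "\<lambda>x. g' x v"] d(4) by simp
  moreover have "Ck_on k S (\<lambda>x. h x v)" for v
    using Ck_on_cong[OF assms(1), of "\<lambda>x. f' x v"] d(2) by (simp add: h_def)
  ultimately have "Ck_on k (S \<union> T) (\<lambda>x. h x v)" for v using Suc.IH by blast
  moreover have "\<forall>x\<in>S\<union>T. (f has_derivative h x) (at x)"
    using d by (auto simp: h_def)
  ultimately show ?case by auto
qed

text \<open>The expansion property of an orthonormal basis. It gives coordinates in an inner product space of
any finite dimension, 0 included.\<close>

definition coords :: "'e::real_inner set \<Rightarrow> bool" where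
  "coords C \<longleftrightarrow> finite C \<and> (\<forall>x. x = (\<Sum>c\<in>C. (x \<bullet> c) *\<^sub>R c))"

lemma coords_sum: "coords C \<Longrightarrow> x = (\<Sum>c\<in>C. (x \<bullet> c) *\<^sub>R c)"
  unfolding coords_def by (elim conjE allE)

lemma coords_finite: "coords C \<Longrightarrow> finite C"
  unfolding coords_def by (elim conjE)

lemma coords_real: "coords {1::real}"
  by (simp add: coords_def)

lemma linear_coords:
  assumes "coords C" "linear L"
  shows "L x = (\<Sum>c\<in>C. (x \<bullet> c) *\<^sub>R L c)"
proof -
  have "L x = L (\<Sum>c\<in>C. (x \<bullet> c) *\<^sub>R c)" by (rule arg_cong[OF coords_sum[OF assms(1)]])
  also have "\<dots> = (\<Sum>c\<in>C. (x \<bullet> c) *\<^sub>R L c)"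
    using assms(2) by (simp add: linear_sum linear_cmul)
  finally show ?thesis .
qed

text \<open>The derivative \<open>g' (f x) (f' x v)\<close> depends on \<open>x\<close> in two places at once. Expanding \<open>f' x v\<close> in
coordinates turns it into a sum of products of the scalar functions \<open>f' x v \<bullet> c\<close> with the
compositions \<open>g' (f x) c\<close>, to which the induction hypothesis applies.\<close>

lemma Ck_on_compose:
  fixes f :: "'a::real_normed_vector \<Rightarrow> 'b::real_inner" and g :: "'b \<Rightarrow> 'c::real_normed_vector"
  assumes C: "coords (C::'b set)" and S: "open S" and fS: "f ` S \<subseteq> T"
  shows "Ck_on k S f \<Longrightarrow> Ck_on k T g \<Longrightarrow> Ck_on k S (\<lambda>x. g (f x))"
  using fS
proof (induction k arbitrary: f g)
  case 0 then show ?case by (auto intro: continuous_on_compose2)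
next
  case (Suc k)
  then obtain f' g' where
    d: "\<forall>x\<in>S. (f has_derivative f' x) (at x)" "\<forall>v. Ck_on k S (\<lambda>x. f' x v)"
    "\<forall>x\<in>T. (g has_derivative g' x) (at x)" "\<forall>v. Ck_on k T (\<lambda>x. g' x v)" by auto
  have chain: "\<forall>x\<in>S. ((\<lambda>x. g (f x)) has_derivative (\<lambda>v. g' (f x) (f' x v))) (at x)"
  proof
    fix x assume "x \<in> S"
    then have "(f has_derivative f' x) (at x)" "(g has_derivative g' (f x)) (at (f x))"
      using d Suc.prems(3) by auto
    then show "((\<lambda>x. g (f x)) has_derivative (\<lambda>v. g' (f x) (f' x v))) (at x)"
      by (rule has_derivative_compose)
  qed
  have "Ck_on k S (\<lambda>x. g' (f x) (f' x v))" for v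
  proof (rule Ck_on_cong[OF S])
    show "(\<Sum>c\<in>C. (f' x v \<bullet> c) *\<^sub>R g' (f x) c) = g' (f x) (f' x v)" if "x \<in> S" for x
    proof -
      have "linear (g' (f x))" using d(3) Suc.prems(3) that has_derivative_linear by blast
      then show ?thesis using linear_coords[OF C, of "g' (f x)" "f' x v"] by simp
    qed
    have "Ck_on k S (\<lambda>x. g' (f x) c)" for c
      using Suc.IH[of f "\<lambda>y. g' y c"] Suc.prems d(4) Ck_on_SucD by blast
    moreover have "Ck_on k S (\<lambda>x. f' x v \<bullet> c)" for c
      using Ck_on_bilinear[OF bounded_bilinear_inner] d(2) Ck_on_const by blast
    ultimately show "Ck_on k S (\<lambda>x. \<Sum>c\<in>C. (f' x v \<bullet> c) *\<^sub>R g' (f x) c)"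
      by (intro Ck_on_sum Ck_on_bilinear[OF bounded_bilinear_scaleR])
  qed
  with chain show ?case by (auto intro!: exI[of _ "\<lambda>x v. g' (f x) (f' x v)"])
qed

text \<open>Gram-Schmidt, one vector at a time.\<close>

lemma coords_exist_span:
  fixes B :: "'e::real_inner set"
  assumes "finite B"
  shows "\<exists>C. finite C \<and> C \<subseteq> span B \<and> (\<forall>x\<in>span B. x = (\<Sum>c\<in>C. (x \<bullet> c) *\<^sub>R c))"
  using assms
proof (induction B)
  case empty
  then show ?case by (intro exI[of _ "{}"]) simp
next
  case (insert b B)
  then obtain C where C: "finite C" "C \<subseteq> span B" "\<And>x. x \<in> span B \<Longrightarrow> x = (\<Sum>c\<in>C. (x \<bullet> c) *\<^sub>R c)"
    by blast
  define Pb where "Pb = (\<Sum>c\<in>C. (b \<bullet> c) *\<^sub>R c)"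
  define b' where "b' = b - Pb"
  have Pb: "Pb \<in> span B" unfolding Pb_def using C(2) by (auto intro!: span_sum span_scale)
  have orth: "b' \<bullet> d = 0" if "d \<in> span B" for d
  proof -
    have "b \<bullet> d = b \<bullet> (\<Sum>c\<in>C. (d \<bullet> c) *\<^sub>R c)" using C(3)[OF that] by simp
    also have "\<dots> = Pb \<bullet> d"
      unfolding Pb_def by (auto simp: inner_sum_left inner_sum_right inner_commute intro!: sum.cong)
    finally show ?thesis by (simp add: b'_def inner_diff_left)
  qed
  have sub: "span B \<subseteq> span (insert b B)" by (simp add: span_mono subset_insertI)
  show ?case
  proof (cases "b' = 0")
    case True
    then have "b \<in> span B" using Pb by (simp add: b'_def)
    then have "span (insert b B) = span B" by (simp add: span_redundant)
    then show ?thesis using C by metis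
  next
    case False
    define e where "e = b' /\<^sub>R norm b'"
    have "norm e = 1" using False by (simp add: e_def)
    then have ee: "e \<bullet> e = 1" by (simp add: dot_square_norm)
    have eo: "e \<bullet> d = 0" "d \<bullet> e = 0" if "d \<in> span B" for d
      using orth[OF that] by (simp_all add: e_def inner_commute)
    have "e \<notin> C" using ee eo C(2) by fastforce
    have "b \<in> span (insert b B)" by (simp add: span_base)
    then have "e \<in> span (insert b B)" unfolding e_def b'_def using Pb sub
      by (intro span_scale span_diff) auto
    moreover have "x = (\<Sum>c\<in>insert e C. (x \<bullet> c) *\<^sub>R c)" if "x \<in> span (insert b B)" for x
    proof -
      obtain k where k: "x - k *\<^sub>R b \<in> span B" using \<open>x \<in> span (insert b B)\<close> span_breakdown_eq by blast
      define z where "z = (x - k *\<^sub>R b) + k *\<^sub>R Pb"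
      have z: "z \<in> span B" unfolding z_def using k Pb by (intro span_add span_scale)
      have x: "x = (k * norm b') *\<^sub>R e + z"
        using False by (simp add: z_def e_def b'_def algebra_simps)
      have "x \<bullet> e = k * norm b'" using ee eo[OF z] by (simp add: x inner_add_left)
      moreover have "(\<Sum>c\<in>C. (x \<bullet> c) *\<^sub>R c) = z"
      proof -
        have "x \<bullet> c = z \<bullet> c" if "c \<in> C" for c
          using eo(1)[of c] that C(2) by (auto simp: x inner_add_left)
        then show ?thesis using C(3)[OF z] by simp
      qed
      ultimately show ?thesis using \<open>e \<notin> C\<close> C(1) x by simp
    qed
    ultimately show ?thesis using C sub by (intro exI[of _ "insert e C"]) auto
  qed
qed

lemma coords_exist:
  fixes B :: "'e::real_inner set"
  assumes "finite B" "span B = UNIV"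
  obtains C :: "'e set" where "coords C"
  using coords_exist_span[OF assms(1)] assms(2) unfolding coords_def by auto

text \<open>A closed ball is a closed subset of a box in coordinates, and a box is built up from intervals, one
coordinate at a time.\<close>

lemma compact_cball_coords:
  fixes a :: "'e::real_inner"
  assumes C: "coords (C::'e set)"
  shows "compact (cball a r)"
proof -
  have box: "finite D \<Longrightarrow> compact ((\<lambda>s. \<Sum>c\<in>D. s c *\<^sub>R c) ` {s. \<forall>c\<in>D. \<bar>s c\<bar> \<le> R})" for R :: real and D :: "'e set"
  proof (induction D rule: finite_induct)
    case empty
    then show ?case by simp
  next
    case (insert d D)
    let ?K = "\<lambda>D. (\<lambda>s. \<Sum>c\<in>D. s c *\<^sub>R c) ` {s. \<forall>c\<in>D. \<bar>s c\<bar> \<le> R}"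
    have "?K (insert d D) = (\<lambda>(t, y). t *\<^sub>R d + y) ` ({-R..R} \<times> ?K D)"
    proof (intro set_eqI iffI)
      fix y assume "y \<in> ?K (insert d D)"
      then show "y \<in> (\<lambda>(t, y). t *\<^sub>R d + y) ` ({-R..R} \<times> ?K D)"
        using insert(1,2) by (auto simp: abs_le_iff image_iff intro!: bexI)
    next
      fix y assume "y \<in> (\<lambda>(t, y). t *\<^sub>R d + y) ` ({-R..R} \<times> ?K D)"
      then obtain t s where ts: "t \<in> {-R..R}" "\<forall>c\<in>D. \<bar>s c\<bar> \<le> R" "y = t *\<^sub>R d + (\<Sum>c\<in>D. s c *\<^sub>R c)"
        by auto
      have "(\<Sum>c\<in>D. (s(d := t)) c *\<^sub>R c) = (\<Sum>c\<in>D. s c *\<^sub>R c)"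
        using insert(2) by (intro sum.cong) auto
      then show "y \<in> ?K (insert d D)"
        using ts insert(1,2) by (auto intro!: image_eqI[of _ _ "s(d := t)"])
    qed
    moreover have "compact ({-R..R} \<times> ?K D)" using insert(3) by (intro compact_Times) auto
    ultimately show ?case
      by (auto intro!: compact_continuous_image continuous_intros simp: case_prod_unfold)
  qed
  have fin: "finite C" using C by (rule coords_finite)
  define R where "R = (norm a + \<bar>r\<bar>) * (\<Sum>c\<in>C. norm c)"
  have "cball a r \<subseteq> (\<lambda>s. \<Sum>c\<in>C. s c *\<^sub>R c) ` {s. \<forall>c\<in>C. \<bar>s c\<bar> \<le> R}"
  proof
    fix x assume "x \<in> cball a r"
    then have "norm x \<le> norm a + \<bar>r\<bar>" using norm_triangle_sub[of x a] by (auto simp: dist_norm norm_minus_commute)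
    then have le: "\<bar>x \<bullet> c\<bar> \<le> R" if "c \<in> C" for c
    proof -
      have "\<bar>x \<bullet> c\<bar> \<le> norm x * norm c" by (rule Cauchy_Schwarz_ineq2)
      also have "\<dots> \<le> (norm a + \<bar>r\<bar>) * (\<Sum>c\<in>C. norm c)"
        using \<open>norm x \<le> _\<close> that fin by (intro mult_mono member_le_sum sum_nonneg) auto
      finally show ?thesis by (simp add: R_def)
    qed
    show "x \<in> (\<lambda>s. \<Sum>c\<in>C. s c *\<^sub>R c) ` {s. \<forall>c\<in>C. \<bar>s c\<bar> \<le> R}"
    proof (rule image_eqI)
      show "x = (\<Sum>c\<in>C. (x \<bullet> c) *\<^sub>R c)" by (rule coords_sum[OF C])
      show "(\<lambda>c. x \<bullet> c) \<in> {s. \<forall>c\<in>C. \<bar>s c\<bar> \<le> R}" using le by simp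
    qed
  qed
  from Int_absorb2[OF this] closed_Int_compact[OF closed_cball box[OF fin, of R], of a r]
  show ?thesis by simp
qed

section \<open>Bump functions\<close>

text \<open>Among these functions are all building blocks of the derivatives of \<open>exp (- 1 / t)\<close>, extended by 0 to
\<open>t \<le> 0\<close>: the family is closed under differentiation up to linear combinations (\<open>exp_tail_deriv\<close>), and so all
its members are smooth.\<close>

definition exp_tail :: "nat \<Rightarrow> real \<Rightarrow> real" where
  "exp_tail m t = (if t > 0 then exp (- 1 / t) / t ^ m else 0)"

lemma exp_tail_tendsto: "(exp_tail m \<longlongrightarrow> 0) (at 0)"
proof -
  have "((\<lambda>t::real. inverse t ^ m / exp (inverse t)) \<longlongrightarrow> 0) (at_right 0)"
    using filterlim_compose[OF tendsto_power_div_exp_0 filterlim_inverse_at_top_right] .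
  then have "(exp_tail m \<longlongrightarrow> 0) (at_right 0)"
    by (rule Lim_transform_eventually)
      (auto simp: eventually_at_right_field exp_tail_def exp_minus field_simps intro!: exI[of _ 1])
  moreover have "(exp_tail m \<longlongrightarrow> 0) (at_left 0)"
    by (rule Lim_transform_eventually[OF tendsto_const])
      (auto simp: eventually_at_left_field exp_tail_def intro!: exI[of _ "-1"])
  ultimately show ?thesis by (simp add: filterlim_at_split)
qed

lemma exp_tail_deriv:
  "(exp_tail m has_real_derivative exp_tail (m + 2) t - m * exp_tail (Suc m) t) (at t)"
proof (cases t "0::real" rule: linorder_cases)
  case less
  have "((\<lambda>_. 0) has_real_derivative 0) (at t)" by simp
  then have "(exp_tail m has_real_derivative 0) (at t)"
    by (rule has_field_derivative_transform_within_open[of _ _ _ "{..<0}"])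
      (use less in \<open>auto simp: exp_tail_def\<close>)
  then show ?thesis using less by (simp add: exp_tail_def)
next
  case equal
  have "((\<lambda>h. exp_tail m h / h) \<longlongrightarrow> 0) (at 0)"
    by (rule Lim_transform_eventually[OF exp_tail_tendsto[of "Suc m"]])
      (auto simp: exp_tail_def eventually_at_filter)
  then show ?thesis using equal by (simp add: DERIV_def exp_tail_def)
next
  case greater
  have "((\<lambda>t. exp (- 1 / t) / t ^ m) has_real_derivative
      exp (- 1 / t) / t ^ (m + 2) - m * (exp (- 1 / t) / t ^ Suc m)) (at t)"
  proof -
    have p: "((\<lambda>t. t ^ m) has_real_derivative m * t ^ m / t) (at t)"
      by (rule DERIV_cong[OF DERIV_pow]) (use greater in \<open>cases m; simp\<close>)
    have e: "((\<lambda>t. exp (- 1 / t)) has_real_derivative exp (- 1 / t) / t\<^sup>2) (at t)"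
      using greater by (auto intro!: derivative_eq_intros simp: power2_eq_square)
    show ?thesis
      by (rule DERIV_cong[OF DERIV_divide[OF e p]])
        (use greater in \<open>simp_all add: field_simps power2_eq_square\<close>)
  qed
  then have "(exp_tail m has_real_derivative
      exp (- 1 / t) / t ^ (m + 2) - m * (exp (- 1 / t) / t ^ Suc m)) (at t)"
    by (rule has_field_derivative_transform_within_open[of _ _ _ "{0<..}"])
      (use greater in \<open>auto simp: exp_tail_def\<close>)
  then show ?thesis using greater by (simp add: exp_tail_def)
qed

lemma Ck_on_exp_tail: "Ck_on k UNIV (exp_tail m)"
proof (induction k arbitrary: m)
  case 0
  have "isCont (exp_tail m) t" for t using exp_tail_deriv DERIV_isCont by blast
  then show ?case by (simp add: continuous_at_imp_continuous_on)
next
  case (Suc k)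
  have "Ck_on k UNIV (\<lambda>t. v * (exp_tail (m + 2) t + (- m) * exp_tail (Suc m) t))" for v
    by (intro Ck_on_bilinear[OF bounded_bilinear_mult] Ck_on_add Ck_on_const Suc)
  moreover have "(exp_tail m has_derivative
      (\<lambda>v. v * (exp_tail (m + 2) t + (- m) * exp_tail (Suc m) t))) (at t)" for t
    using exp_tail_deriv[of m t] unfolding has_field_derivative_def
    by (rule has_derivative_eq_rhs) (simp add: fun_eq_iff)
  ultimately show ?case
    by (auto intro!: exI[of _ "\<lambda>t v. v * (exp_tail (m + 2) t + (- m) * exp_tail (Suc m) t)"])
qed

lemma smooth_bump:
  fixes a :: "'e::real_inner"
  assumes "r > 0"
  obtains b :: "'e \<Rightarrow> real" where "smooth_on UNIV b" "b a \<noteq> 0" "\<And>x. x \<notin> cball a r \<Longrightarrow> b x = 0"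
proof
  let ?s = "\<lambda>x. r\<^sup>2 + (-1) * ((x - a) \<bullet> (x - a))"
  have id: "Ck_on k UNIV (\<lambda>x::'e. x)" for k by (rule Ck_on_linear[OF bounded_linear_ident])
  have "Ck_on k UNIV ?s" for k
    by (intro Ck_on_add Ck_on_const Ck_on_bilinear[OF bounded_bilinear_mult]
        Ck_on_bilinear[OF bounded_bilinear_inner])
      (use Ck_on_add[OF id Ck_on_const[of _ _ "- a"]] in simp_all)
  then show "smooth_on UNIV (\<lambda>x. exp_tail 0 (?s x))"
    unfolding smooth_on_def using Ck_on_compose[OF coords_real open_UNIV subset_UNIV _ Ck_on_exp_tail] by blast
  show "exp_tail 0 (?s a) \<noteq> 0" using assms by (simp add: exp_tail_def)
  show "exp_tail 0 (?s x) = 0" if "x \<notin> cball a r" for x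
  proof -
    have "r < norm (x - a)" using that by (simp add: dist_norm norm_minus_commute)
    then have "r\<^sup>2 < (norm (x - a))\<^sup>2" using assms by (intro power_strict_mono) auto
    then show ?thesis by (simp add: exp_tail_def power2_norm_eq_inner)
  qed
qed

lemma Ck_on_imp_continuous: "Ck_on k S f \<Longrightarrow> continuous_on S f"
  by (induction k) (simp, blast dest: Ck_on_SucD)

section \<open>Hadamard's lemma\<close>

lemma smooth_on_derivative:
  fixes f :: "'e::real_normed_vector \<Rightarrow> 'f::real_normed_vector"
  assumes S: "open S" and f: "smooth_on S f"
  shows "smooth_on S (\<lambda>x. frechet_derivative f (at x) v)"
  unfolding smooth_on_def
proof
  fix k
  obtain f' where f': "\<forall>x\<in>S. (f has_derivative f' x) (at x)" "\<forall>v. Ck_on k S (\<lambda>x. f' x v)"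
    using f[unfolded smooth_on_def, rule_format, of "Suc k"] by auto
  have "f' x v = frechet_derivative f (at x) v" if "x \<in> S" for x
    using f'(1) that frechet_derivative_at by metis
  then show "Ck_on k S (\<lambda>x. frechet_derivative f (at x) v)"
    using Ck_on_cong[OF S, of "\<lambda>x. f' x v"] f'(2) by simp
qed

lemma smooth_on_has_derivative:
  assumes "smooth_on S f" "x \<in> S"
  shows "(f has_derivative frechet_derivative f (at x)) (at x)"
proof -
  have "f differentiable (at x)"
    using assms(1)[unfolded smooth_on_def, rule_format, of 1] assms(2) by (auto simp: differentiable_def)
  then show ?thesis by (simp add: frechet_derivative_works)
qed

text \<open>Uniform continuity of finitely many functions near a compact set, including points outside it: a
Lebesgue number of a cover by open sets on which all the functions oscillate by less than \<open>e\<close>.\<close>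

lemma uniform_nhd_of_compact:
  fixes u :: "'i \<Rightarrow> 'e::metric_space \<Rightarrow> 'f::metric_space"
  assumes K: "compact K" and S: "open S" "K \<subseteq> S" and I: "finite I"
    and u: "\<And>i. i \<in> I \<Longrightarrow> continuous_on S (u i)" and e: "e > 0"
  obtains d where "d > 0"
    "\<And>y w i. y \<in> K \<Longrightarrow> dist y w < d \<Longrightarrow> i \<in> I \<Longrightarrow> w \<in> S \<and> dist (u i w) (u i y) < e"
proof -
  define \<G> where "\<G> = {G. open G \<and> G \<subseteq> S \<and> (\<forall>i\<in>I. \<forall>x\<in>G. \<forall>y\<in>G. dist (u i x) (u i y) < e)}"
  have "K \<subseteq> \<Union>\<G>"
  proof
    fix y assume "y \<in> K"
    then have y: "y \<in> S" using S by auto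
    have "\<forall>\<^sub>F w in nhds y. dist (u i w) (u i y) < e / 2" if "i \<in> I" for i
    proof -
      have "isCont (u i) y" using u[OF that] S(1) y continuous_on_eq_continuous_at by blast
      then have "\<forall>\<^sub>F w in at y. dist (u i w) (u i y) < e / 2"
        using e unfolding isCont_def by (intro tendstoD) auto
      then show ?thesis using e by (simp add: eventually_nhds_conv_at)
    qed
    then have "\<forall>\<^sub>F w in nhds y. w \<in> S \<and> (\<forall>i\<in>I. dist (u i w) (u i y) < e / 2)"
      using I S(1) y by (intro eventually_conj eventually_ball_finite eventually_nhds_in_open) auto
    then obtain G where G: "open G" "y \<in> G" "\<forall>w\<in>G. w \<in> S \<and> (\<forall>i\<in>I. dist (u i w) (u i y) < e / 2)"
      by (auto simp: eventually_nhds)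
    then have "G \<in> \<G>" unfolding \<G>_def by (blast intro: dist_triangle_half_l)
    then show "y \<in> \<Union>\<G>" using G by auto
  qed
  then obtain d where d: "d > 0" "\<forall>y\<in>K. \<exists>G\<in>\<G>. ball y d \<subseteq> G"
    using Heine_Borel_lemma[OF K] unfolding \<G>_def by (metis (no_types, lifting) mem_Collect_eq)
  show thesis
  proof
    show "d > 0" by fact
    fix y w i assume *: "y \<in> K" "dist y w < d" "i \<in> I"
    then obtain G where "G \<in> \<G>" "ball y d \<subseteq> G" using d by blast
    moreover have "y \<in> ball y d" "w \<in> ball y d" using d(1) * by auto
    ultimately show "w \<in> S \<and> dist (u i w) (u i y) < e" using *(3) unfolding \<G>_def by blast
  qed
qed

text \<open>Differentiation under the integral sign. The error of the linear approximation of \<open>u\<close> at the points of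
the segment from \<open>q\<close> to \<open>x\<close> is bounded uniformly by the mean value inequality, since the directional
derivatives of \<open>u\<close> vary little in a uniform neighbourhood of this compact segment.\<close>

lemma has_derivative_segment_integral:
  fixes u :: "'e::real_inner \<Rightarrow> real"
  assumes C: "coords (C::'e set)" and S: "open S" "convex S" and q: "q \<in> S" and x: "x \<in> S"
    and u: "\<And>y. y \<in> S \<Longrightarrow> (u has_derivative u' y) (at y)"
    and u': "\<And>c. continuous_on S (\<lambda>y. u' y c)"
  shows "((\<lambda>x. integral {0..1} (\<lambda>t. t ^ m * u (q + t *\<^sub>R (x - q)))) has_derivative
    (\<lambda>v. \<Sum>c\<in>C. (v \<bullet> c) * integral {0..1} (\<lambda>t. t ^ Suc m * u' (q + t *\<^sub>R (x - q)) c))) (at x)"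
proof -
  define y where "y t x = q + t *\<^sub>R (x - q)" for t x
  have y: "y t x \<in> S" if "t \<in> {0..1}" "x \<in> S" for t x
  proof -
    have "y t x = (1 - t) *\<^sub>R q + t *\<^sub>R x" by (simp add: y_def algebra_simps)
    then show ?thesis using that q S(2) by (auto simp: convex_alt)
  qed
  have cont_y: "continuous_on {0..1} (\<lambda>t. y t x)" for x unfolding y_def by (intro continuous_intros)
  have cont_u: "continuous_on S u"
    using u by (auto intro!: continuous_at_imp_continuous_on dest: has_derivative_continuous)
  have int_u: "(\<lambda>t. t ^ m * u (y t x)) integrable_on {0..1}" if "x \<in> S" for x
    using y that
    by (intro integrable_continuous_real continuous_intros continuous_on_compose2[OF cont_u cont_y]) auto
  have int_u': "(\<lambda>t. t ^ Suc m * u' (y t x) c) integrable_on {0..1}" for c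
    using y x
    by (intro integrable_continuous_real continuous_intros continuous_on_compose2[OF u' cont_y]) auto
  define G where "G x = integral {0..1} (\<lambda>t. t ^ m * u (y t x))" for x
  define L where "L v = (\<Sum>c\<in>C. (v \<bullet> c) * integral {0..1} (\<lambda>t. t ^ Suc m * u' (y t x) c))" for v
  have fin: "finite C" using C by (rule coords_finite)
  have bl: "bounded_linear L"
    unfolding L_def by (intro bounded_linear_sum bounded_linear_mult_left bounded_linear_inner_left
        bounded_linear_compose[OF bounded_linear_mult_left])
  have L_int: "((\<lambda>t. t ^ m * u' (y t x) (t *\<^sub>R v)) has_integral L v) {0..1}" for v
  proof -
    have "((\<lambda>t. \<Sum>c\<in>C. (v \<bullet> c) * (t ^ Suc m * u' (y t x) c)) has_integral L v) {0..1}"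
      unfolding L_def using int_u' fin
      by (intro has_integral_sum has_integral_mult_right) (auto simp: has_integral_integrable_integral)
    moreover have "(\<Sum>c\<in>C. (v \<bullet> c) * (t ^ Suc m * u' (y t x) c)) = t ^ m * u' (y t x) (t *\<^sub>R v)"
      if "t \<in> {0..1}" for t
    proof -
      have lin: "linear (u' (y t x))" using u[OF y[OF that x]] has_derivative_linear by blast
      then have "u' (y t x) v = (\<Sum>c\<in>C. (v \<bullet> c) * u' (y t x) c)"
        using linear_coords[OF C lin, of v] by simp
      then show ?thesis using lin by (simp add: linear_cmul sum_distrib_left mult_ac)
    qed
    ultimately show ?thesis by (rule has_integral_eq[rotated]) auto
  qed
  have "(G has_derivative L) (at x)"
    unfolding has_derivative_at_alt
  proof (intro conjI bl allI impI)
    fix e :: real assume e: "e > 0"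
    \<comment> \<open>A tolerance of \<open>e / s\<close> for each coordinate gives \<open>e\<close> in total; adding 1 keeps \<open>s\<close> positive.\<close>
    define s where "s = (\<Sum>c\<in>C. norm c) + 1"
    have s: "s > 0" unfolding s_def by (simp add: sum_nonneg add_nonneg_pos)
    have "compact ((\<lambda>t. y t x) ` {0..1})" using cont_y by (intro compact_continuous_image) auto
    moreover have "(\<lambda>t. y t x) ` {0..1} \<subseteq> S" using y x by auto
    moreover have "e / s > 0" using e s by simp
    ultimately obtain d where d: "d > 0" and dd: "\<And>z w c. z \<in> (\<lambda>t. y t x) ` {0..1} \<Longrightarrow> dist z w < d \<Longrightarrow> c \<in> C \<Longrightarrow>
        w \<in> S \<and> dist (u' w c) (u' z c) < e / s"
      using uniform_nhd_of_compact[OF _ S(1) _ fin u', of _ "e / s" "\<lambda>c. c"] by metis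
    obtain d2 where d2: "d2 > 0" "ball x d2 \<subseteq> S" using S(1) x open_contains_ball by blast
    have "norm (G z - G x - L (z - x)) \<le> e * norm (z - x)" if z: "norm (z - x) < min d d2" for z
    proof -
      have zS: "z \<in> S" using z d2 by (auto simp: dist_norm norm_minus_commute subset_iff)
      let ?f = "\<lambda>t. t ^ m * u (y t z) - t ^ m * u (y t x) - t ^ m * u' (y t x) (t *\<^sub>R (z - x))"
      have "(?f has_integral (G z - G x - L (z - x))) {0..1}"
        unfolding G_def using int_u[OF zS] int_u[OF x] L_int
        by (intro has_integral_diff) (auto simp: has_integral_integrable_integral)
      moreover have "norm (?f t) \<le> e * norm (z - x)" if t: "t \<in> {0..1}" for t
      proof -
        have bnd: "norm (y t z - y t x) \<le> norm (z - x)"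
          using t by (simp add: y_def mult_left_le_one_le flip: scaleR_diff_right)
        have yz: "y t z - y t x = t *\<^sub>R (z - x)" by (simp add: y_def algebra_simps)
        let ?B = "ball (y t x) d \<inter> S"
        have "norm (u (y t z) - u (y t x) - u' (y t x) (y t z - y t x)) \<le> norm (y t z - y t x) * e"
        proof (rule differentiable_bound_linearization[where S = ?B])
          show "y t x \<in> ?B" using d y[OF t x] by simp
          have "y t z \<in> ?B" using bnd z y[OF t zS] by (auto simp: dist_norm norm_minus_commute)
          with \<open>y t x \<in> ?B\<close> show "y t x + r *\<^sub>R (y t z - y t x) \<in> ?B" if "r \<in> {0..1}" for r
          proof -
            have "y t x + r *\<^sub>R (y t z - y t x) = (1 - r) *\<^sub>R y t x + r *\<^sub>R y t z"
              by (simp add: algebra_simps)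
            moreover have "convex ?B" using S(2) by (intro convex_Int convex_ball)
            ultimately show ?thesis
              using that \<open>y t x \<in> ?B\<close> \<open>y t z \<in> ?B\<close> using S(2) by (auto intro!: convexD simp del: Int_iff)
          qed
          show "(u has_derivative u' w) (at w within ?B)" if "w \<in> ?B" for w
            using u that has_derivative_at_withinI by blast
          show "onorm (u' w - u' (y t x)) \<le> e" if w: "w \<in> ?B" for w
            unfolding fun_diff_def
          proof (rule onorm_bound)
            show "0 \<le> e" using e by simp
          next
            fix v
            have "linear (\<lambda>v. u' w v - u' (y t x) v)"
              using u[of w] u[OF y[OF t x]] w by (intro linear_compose_sub) (auto intro: has_derivative_linear)
            from linear_coords[OF C this, of v]
            have "norm (u' w v - u' (y t x) v) \<le> (\<Sum>c\<in>C. \<bar>v \<bullet> c\<bar> * \<bar>u' w c - u' (y t x) c\<bar>)"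
              by (simp add: abs_mult sum_abs flip: abs_mult)
            also have "\<dots> \<le> (\<Sum>c\<in>C. (norm v * norm c) * (e / s))"
            proof (intro sum_mono mult_mono Cauchy_Schwarz_ineq2)
              fix c assume "c \<in> C"
              then show "\<bar>u' w c - u' (y t x) c\<bar> \<le> e / s"
                using dd[of "y t x" w c] w t by (auto simp: dist_real_def)
            qed auto
            also have "\<dots> = norm v * (e * ((s - 1) / s))"
              by (simp add: s_def sum_distrib_left sum_distrib_right sum_divide_distrib mult_ac)
            also have "\<dots> \<le> norm v * (e * 1)"
              using e s by (intro mult_left_mono) auto
            finally show "norm (u' w v - u' (y t x) v) \<le> e * norm v" by (simp add: mult_ac)
          qed
        qed
        then have *: "\<bar>u (y t z) - u (y t x) - u' (y t x) (t *\<^sub>R (z - x))\<bar> \<le> e * norm (y t z - y t x)"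
          by (simp add: yz mult_ac)
        have "norm (?f t) = t ^ m * \<bar>u (y t z) - u (y t x) - u' (y t x) (t *\<^sub>R (z - x))\<bar>"
          using t by (simp add: abs_mult flip: right_diff_distrib)
        also have "\<dots> \<le> 1 * (e * norm (y t z - y t x))"
          using t * by (intro mult_mono) (auto simp: power_le_one)
        also have "\<dots> \<le> e * norm (z - x)" using bnd e by simp
        finally show ?thesis .
      qed
      ultimately show ?thesis
        using has_integral_bound_real[of "e * norm (z - x)" "{}" ?f "G z - G x - L (z - x)" 0 1] e by simp
    qed
    then show "\<exists>d>0. \<forall>z. norm (z - x) < d \<longrightarrow> norm (G z - G x - L (z - x)) \<le> e * norm (z - x)"
      using d d2 by (intro exI[of _ "min d d2"]) auto
  qed
  then show ?thesis unfolding G_def L_def y_def .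
qed

text \<open>The derivative of such an integral is a linear combination of integrals of the same kind, with the
weight \<open>t ^ Suc m\<close> and a directional derivative of \<open>u\<close>. This is why the weight \<open>t ^ m\<close> is carried along.\<close>

lemma Ck_on_segment_integral:
  fixes u :: "'e::real_inner \<Rightarrow> real"
  assumes C: "coords (C::'e set)" and S: "open S" "convex S" and q: "q \<in> S"
  shows "Ck_on (Suc k) S u \<Longrightarrow> Ck_on k S (\<lambda>x. integral {0..1} (\<lambda>t. t ^ m * u (q + t *\<^sub>R (x - q))))"
proof (induction k arbitrary: u m)
  case 0
  then obtain u' where u': "\<And>y. y \<in> S \<Longrightarrow> (u has_derivative u' y) (at y)" "\<And>c. continuous_on S (\<lambda>y. u' y c)"
    by auto
  show ?case unfolding Ck_on.simps
  proof (intro continuous_at_imp_continuous_on ballI)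
    fix x assume "x \<in> S"
    from has_derivative_continuous[OF has_derivative_segment_integral[OF C S q this u']]
    show "isCont (\<lambda>x. integral {0..1} (\<lambda>t. t ^ m * u (q + t *\<^sub>R (x - q)))) x" .
  qed
next
  case (Suc k)
  then obtain u' where u': "\<And>y. y \<in> S \<Longrightarrow> (u has_derivative u' y) (at y)" "\<And>c. Ck_on (Suc k) S (\<lambda>y. u' y c)"
    by (metis Ck_on.simps(2))
  have cont: "continuous_on S (\<lambda>y. u' y c)" for c
    using u'(2) by (rule Ck_on_imp_continuous)
  let ?L = "\<lambda>x v. \<Sum>c\<in>C. (v \<bullet> c) * integral {0..1} (\<lambda>t. t ^ Suc m * u' (q + t *\<^sub>R (x - q)) c)"
  have "Ck_on k S (\<lambda>x. ?L x v)" for v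
    by (intro Ck_on_sum Ck_on_bilinear[OF bounded_bilinear_mult] Ck_on_const Suc.IH u'(2))
  moreover have "((\<lambda>x. integral {0..1} (\<lambda>t. t ^ m * u (q + t *\<^sub>R (x - q)))) has_derivative ?L x) (at x)"
    if "x \<in> S" for x
    using that u'(1) cont by (intro has_derivative_segment_integral[OF C S q])
  ultimately show ?case unfolding Ck_on.simps by (intro exI[of _ ?L] conjI ballI allI)
qed

text \<open>With \<open>g c x = (\<integral>t\<in>{0..1}. \<partial>\<^sub>c f (q + t (x - q)))\<close> this is the fundamental theorem of calculus along the segment
from \<open>q\<close> to \<open>x\<close>. The point is that the quotients \<open>g c\<close> are again smooth, so that a derivation can be
applied to the products.\<close>

lemma Hadamard:
  fixes f :: "'e::real_inner \<Rightarrow> real"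
  assumes C: "coords (C::'e set)" and S: "open S" "convex S" and q: "q \<in> S"
    and f: "smooth_on S f"
  obtains g where "\<forall>c. smooth_on S (g c)"
    "\<forall>x\<in>S. f x = f q + (\<Sum>c\<in>C. ((x - q) \<bullet> c) * g c x)"
    "\<forall>c. g c q = frechet_derivative f (at q) c"
proof -
  let ?f' = "\<lambda>x. frechet_derivative f (at x)"
  let ?g = "\<lambda>c x. integral {0..1} (\<lambda>t. t ^ 0 * ?f' (q + t *\<^sub>R (x - q)) c)"
  have f': "(f has_derivative ?f' x) (at x)" if "x \<in> S" for x
    using smooth_on_has_derivative[OF f that] .
  have sm: "Ck_on k S (\<lambda>x. ?f' x c)" for k c
    using smooth_on_derivative[OF S(1) f] by (simp add: smooth_on_def)
  show thesis
  proof
    show "\<forall>c. smooth_on S (?g c)"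
      unfolding smooth_on_def by (intro allI Ck_on_segment_integral[OF C S q] sm)
    show "\<forall>c. ?g c q = ?f' q c" by simp
    show "\<forall>x\<in>S. f x = f q + (\<Sum>c\<in>C. ((x - q) \<bullet> c) * ?g c x)"
    proof
      fix x assume x: "x \<in> S"
      have y: "q + t *\<^sub>R (x - q) \<in> S" if "t \<in> {0..1}" for t
      proof -
        have "q + t *\<^sub>R (x - q) = (1 - t) *\<^sub>R q + t *\<^sub>R x" by (simp add: algebra_simps)
        then show ?thesis using that q x S(2) by (auto simp: convex_alt)
      qed
      have "((\<lambda>t. ?f' (q + t *\<^sub>R (x - q)) (x - q)) has_integral f (q + 1 *\<^sub>R (x - q)) - f (q + 0 *\<^sub>R (x - q))) {0..1}"
      proof (rule fundamental_theorem_of_calculus)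
        fix t :: real assume t: "t \<in> {0..1}"
        have "((\<lambda>t. q + t *\<^sub>R (x - q)) has_vector_derivative (x - q)) (at t within {0..1})"
          by (auto intro!: derivative_eq_intros)
        from vector_derivative_diff_chain_within[OF this has_derivative_at_withinI[OF f'[OF y[OF t]]]]
        show "((\<lambda>t. f (q + t *\<^sub>R (x - q))) has_vector_derivative ?f' (q + t *\<^sub>R (x - q)) (x - q)) (at t within {0..1})"
          by (simp add: o_def)
      qed simp
      moreover have "((\<lambda>t. ?f' (q + t *\<^sub>R (x - q)) (x - q)) has_integral (\<Sum>c\<in>C. ((x - q) \<bullet> c) * ?g c x)) {0..1}"
      proof (rule has_integral_eq)
        show "(\<Sum>c\<in>C. ((x - q) \<bullet> c) * ?f' (q + t *\<^sub>R (x - q)) c) = ?f' (q + t *\<^sub>R (x - q)) (x - q)" if "t \<in> {0..1}" for t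
          using linear_coords[OF C has_derivative_linear[OF f'[OF y[OF that]]], of "x - q"] by simp
        have "(\<lambda>t. ?f' (q + t *\<^sub>R (x - q)) c) integrable_on {0..1}" for c
        proof (rule integrable_continuous_real, rule continuous_on_compose2[of S "\<lambda>x. ?f' x c"])
          show "continuous_on S (\<lambda>x. ?f' x c)" using sm by (rule Ck_on_imp_continuous)
          show "continuous_on {0..1} (\<lambda>t. q + t *\<^sub>R (x - q))" by (intro continuous_intros)
          show "(\<lambda>t. q + t *\<^sub>R (x - q)) ` {0..1} \<subseteq> S" using y by blast
        qed
        then have "((\<lambda>t. ?f' (q + t *\<^sub>R (x - q)) c) has_integral ?g c x) {0..1}" for c
          unfolding power_0 mult_1 by (rule integrable_integral)
        then show "((\<lambda>t. \<Sum>c\<in>C. ((x - q) \<bullet> c) * ?f' (q + t *\<^sub>R (x - q)) c) has_integral (\<Sum>c\<in>C. ((x - q) \<bullet> c) * ?g c x)) {0..1}"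
          by (intro has_integral_sum has_integral_mult_right coords_finite[OF C])
      qed
      ultimately have "f x - f q = (\<Sum>c\<in>C. ((x - q) \<bullet> c) * ?g c x)"
        by (auto dest: has_integral_unique)
      then show "f x = f q + (\<Sum>c\<in>C. ((x - q) \<bullet> c) * ?g c x)" by simp
    qed
  qed
qed

section \<open>Smooth functions on a manifold\<close>

lemma smooth_on_subset: "smooth_on S f \<Longrightarrow> T \<subseteq> S \<Longrightarrow> smooth_on T f"
  unfolding smooth_on_def using Ck_on_subset by blast

lemma smooth_on_cong:
  "open S \<Longrightarrow> smooth_on S f \<Longrightarrow> (\<And>x. x \<in> S \<Longrightarrow> f x = g x) \<Longrightarrow> smooth_on S g"
  unfolding smooth_on_def using Ck_on_cong by blast

lemma smooth_on_const: "smooth_on S (\<lambda>x. c)"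
  unfolding smooth_on_def using Ck_on_const by blast

lemma smooth_on_add: "smooth_on S f \<Longrightarrow> smooth_on S g \<Longrightarrow> smooth_on S (\<lambda>x. f x + g x)"
  unfolding smooth_on_def using Ck_on_add by blast

lemma smooth_on_mult:
  fixes f :: "'a::real_normed_vector \<Rightarrow> real"
  shows "smooth_on S f \<Longrightarrow> smooth_on S g \<Longrightarrow> smooth_on S (\<lambda>x. f x * g x)"
  unfolding smooth_on_def using Ck_on_bilinear[OF bounded_bilinear_mult] by blast

lemma smooth_on_inner: "smooth_on S (\<lambda>x. x \<bullet> c)"
  unfolding smooth_on_def using Ck_on_linear[OF bounded_linear_inner_left] by blast

lemma smooth_funsI:
  "(\<And>p. p \<notin> pts M \<Longrightarrow> f p = 0) \<Longrightarrow>
    (\<And>U \<phi>. (U, \<phi>) \<in> atlas M \<Longrightarrow> smooth_on (\<phi> ` U) (f \<circ> inv_into U \<phi>)) \<Longrightarrow> f \<in> smooth_funs M"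
  unfolding smooth_funs_def by blast

lemma smooth_funsD:
  "f \<in> smooth_funs M \<Longrightarrow> (U, \<phi>) \<in> atlas M \<Longrightarrow> smooth_on (\<phi> ` U) (f \<circ> inv_into U \<phi>)"
  unfolding smooth_funs_def by blast

lemma smooth_funs_combo:
  "f \<in> smooth_funs M \<Longrightarrow> g \<in> smooth_funs M \<Longrightarrow> (\<lambda>x. a * f x + b * g x) \<in> smooth_funs M"
  by (fastforce simp: smooth_funs_def o_def intro!: smooth_on_add smooth_on_mult smooth_on_const)

lemma smooth_funs_mult:
  "f \<in> smooth_funs M \<Longrightarrow> g \<in> smooth_funs M \<Longrightarrow> (\<lambda>x. f x * g x) \<in> smooth_funs M"
  by (fastforce simp: smooth_funs_def o_def intro!: smooth_on_mult)

lemma smooth_funs_zero: "(\<lambda>x. 0) \<in> smooth_funs M"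
  by (auto simp: smooth_funs_def o_def intro!: smooth_on_const)

lemma smooth_funs_add:
  "f \<in> smooth_funs M \<Longrightarrow> g \<in> smooth_funs M \<Longrightarrow> (\<lambda>x. f x + g x) \<in> smooth_funs M"
  using smooth_funs_combo[of f M g 1 1] by simp

lemma smooth_funs_diff:
  "f \<in> smooth_funs M \<Longrightarrow> g \<in> smooth_funs M \<Longrightarrow> (\<lambda>x. f x - g x) \<in> smooth_funs M"
  using smooth_funs_combo[of f M g 1 "-1"] by simp

lemma smooth_funs_cmult:
  "f \<in> smooth_funs M \<Longrightarrow> (\<lambda>x. c * f x) \<in> smooth_funs M"
  using smooth_funs_combo[of f M f c 0] by simp

lemma smooth_funs_sum:
  "(\<And>i. i \<in> I \<Longrightarrow> f i \<in> smooth_funs M) \<Longrightarrow> (\<lambda>x. \<Sum>i\<in>I. f i x) \<in> smooth_funs M"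
  by (induction I rule: infinite_finite_induct) (auto intro: smooth_funs_zero smooth_funs_add)

lemma chart_facts:
  assumes "smooth_manifold M" "(U, \<phi>) \<in> atlas M"
  shows "openin (mtop M) U" "U \<subseteq> pts M" "open (\<phi> ` U)" "inj_on \<phi> U"
    "homeomorphic_map (subtopology (mtop M) U) (top_of_set (\<phi> ` U)) \<phi>"
proof -
  show *: "openin (mtop M) U" "open (\<phi> ` U)"
    "homeomorphic_map (subtopology (mtop M) U) (top_of_set (\<phi> ` U)) \<phi>"
    using assms unfolding smooth_manifold_def by fast+
  show U: "U \<subseteq> pts M" using *(1) by (rule openin_subset)
  then have "topspace (subtopology (mtop M) U) = U" by auto
  then show "inj_on \<phi> U" using homeomorphic_imp_injective_map[OF *(3)] by simp
qed

lemma chart_image_open: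
  assumes "smooth_manifold M" "(U, \<phi>) \<in> atlas M" "openin (mtop M) W"
  shows "open (\<phi> ` (U \<inter> W))"
proof -
  note c = chart_facts[OF assms(1,2)]
  have "openin (subtopology (mtop M) U) (U \<inter> W)"
    using assms(3) by (auto simp: openin_subtopology)
  then have "openin (top_of_set (\<phi> ` U)) (\<phi> ` (U \<inter> W))"
    using homeomorphic_imp_open_map[OF c(5)] by (auto simp: open_map_def)
  then show ?thesis using c(3) by (simp add: openin_open_eq)
qed

lemma chart_preimage_open:
  assumes "smooth_manifold M" "(U, \<phi>) \<in> atlas M" "open T"
  shows "openin (mtop M) {q \<in> U. \<phi> q \<in> T}"
proof -
  note c = chart_facts[OF assms(1,2)]
  have "openin (top_of_set (\<phi> ` U)) (\<phi> ` U \<inter> T)" using assms(3) by (auto simp: openin_open)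
  from openin_continuous_map_preimage[OF homeomorphic_imp_continuous_map[OF c(5)] this]
  have "openin (subtopology (mtop M) U) {q \<in> U. \<phi> q \<in> T}"
    by (rule back_subst[where P = "openin _"]) (use c(2) in auto)
  then show ?thesis using c(1) openin_trans_full by blast
qed

text \<open>Compactness passes to the manifold, and there compact sets are closed because the topology is
Hausdorff. This is what allows functions with compact support in a chart to be extended by 0.\<close>

lemma chart_preimage_closed:
  assumes "smooth_manifold M" "(U, \<phi>) \<in> atlas M" "compact K" "K \<subseteq> \<phi> ` U"
  shows "closedin (mtop M) {q \<in> U. \<phi> q \<in> K}"
proof -
  note c = chart_facts[OF assms(1,2)]
  obtain \<psi> where \<psi>: "homeomorphic_maps (subtopology (mtop M) U) (top_of_set (\<phi> ` U)) \<phi> \<psi>"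
    using c(5) homeomorphic_map_maps by blast
  have "compactin (top_of_set (\<phi> ` U)) K" using assms(3,4) by (simp add: compactin_subtopology)
  then have "compactin (subtopology (mtop M) U) (\<psi> ` K)"
    using \<psi> image_compactin unfolding homeomorphic_maps_def by blast
  then have "compactin (mtop M) (\<psi> ` K)" by (simp add: compactin_subtopology)
  moreover have "\<psi> ` K = {q \<in> U. \<phi> q \<in> K}"
  proof -
    have inv: "\<And>q. q \<in> U \<Longrightarrow> \<psi> (\<phi> q) = q"
      using \<psi> c(2) unfolding homeomorphic_maps_def by auto
    show ?thesis
    proof (intro set_eqI iffI)
      fix q assume "q \<in> \<psi> ` K"
      then obtain u where "u \<in> U" "\<phi> u \<in> K" "q = \<psi> (\<phi> u)" using assms(4) by auto
      then show "q \<in> {q \<in> U. \<phi> q \<in> K}" using inv by simp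
    next
      fix q assume "q \<in> {q \<in> U. \<phi> q \<in> K}"
      then show "q \<in> \<psi> ` K" using inv[of q] by (metis (mono_tags, lifting) image_eqI mem_Collect_eq)
    qed
  qed
  moreover have "Hausdorff_space (mtop M)" using assms(1) by (simp add: smooth_manifold_def)
  ultimately show ?thesis using compactin_imp_closedin by metis
qed

lemma smooth_funs_const:
  assumes "smooth_manifold M"
  shows "(\<lambda>x. if x \<in> pts M then c else 0) \<in> smooth_funs M"
proof -
  have "smooth_on (\<phi> ` U) ((\<lambda>x. if x \<in> pts M then c else 0) \<circ> inv_into U \<phi>)" if "(U, \<phi>) \<in> atlas M" for U \<phi>
  proof (rule smooth_on_cong[OF _ smooth_on_const[of _ c]])
    show "open (\<phi> ` U)" using chart_facts[OF assms that] by simp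
    fix x assume "x \<in> \<phi> ` U"
    then have "inv_into U \<phi> x \<in> pts M"
      by (rule subsetD[OF chart_facts(2)[OF assms that] inv_into_into])
    then show "c = ((\<lambda>x. if x \<in> pts M then c else 0) \<circ> inv_into U \<phi>) x" by simp
  qed
  then show ?thesis by (rule smooth_funsI[rotated]) (auto split: if_splits)
qed

definition chart_ext :: "'a set \<Rightarrow> ('a \<Rightarrow> 'e) \<Rightarrow> 'e set \<Rightarrow> ('e \<Rightarrow> real) \<Rightarrow> 'a \<Rightarrow> real" where
  "chart_ext U \<phi> T g = (\<lambda>q. if q \<in> U \<and> \<phi> q \<in> T then g (\<phi> q) else 0)"

lemma manifold_coords:
  fixes M :: "('a, 'e::real_inner) manifold"
  assumes "smooth_manifold M"
  obtains C :: "'e set" where "coords C"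
proof -
  from assms obtain B :: "'e set" where "finite B" "span B = UNIV"
    unfolding smooth_manifold_def by (elim conjE exE)
  then show thesis using that by (rule coords_exist)
qed

text \<open>In any other chart the extension is a composition with a transition map on the part that comes from \<open>T\<close>,
and it is 0 on the complement of the closed set that corresponds to \<open>K\<close>. These two open sets cover the chart.\<close>

lemma chart_ext_smooth:
  fixes M :: "('a, 'e::real_inner) manifold"
  assumes M: "smooth_manifold M" and ch: "(U, \<phi>) \<in> atlas M"
    and T: "open T" "T \<subseteq> \<phi> ` U" and K: "compact K" "K \<subseteq> T"
    and g: "smooth_on T g" "\<And>x. x \<in> T \<Longrightarrow> x \<notin> K \<Longrightarrow> g x = 0"
  shows "chart_ext U \<phi> T g \<in> smooth_funs M"
proof -
  obtain C :: "'e set" where C: "coords C" using manifold_coords[OF M] .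
  have "smooth_on (\<psi> ` V) (chart_ext U \<phi> T g \<circ> inv_into V \<psi>)" if ch2: "(V, \<psi>) \<in> atlas M" for V \<psi>
  proof -
    note cV = chart_facts[OF M ch2]
    define W where "W = {q \<in> U. \<phi> q \<in> T}"
    define L where "L = {q \<in> U. \<phi> q \<in> K}"
    define S1 where "S1 = \<psi> ` (V \<inter> W)"
    define S2 where "S2 = \<psi> ` (V \<inter> (pts M - L))"
    have inv: "inv_into V \<psi> (\<psi> q) = q" if "q \<in> V" for q using cV(4) that by simp
    have "openin (mtop M) W" unfolding W_def using chart_preimage_open[OF M ch T(1)] .
    then have o1: "open S1" unfolding S1_def by (rule chart_image_open[OF M ch2])
    have "closedin (mtop M) L" unfolding L_def using chart_preimage_closed[OF M ch K(1)] K(2) T(2) by blast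
    then have "openin (mtop M) (pts M - L)" by (simp add: openin_diff)
    then have o2: "open S2" unfolding S2_def by (rule chart_image_open[OF M ch2])
    have un: "\<psi> ` V = S1 \<union> S2" unfolding S1_def S2_def W_def L_def using cV(2) K(2) by blast
    have "smooth_on S1 (chart_ext U \<phi> T g \<circ> inv_into V \<psi>)"
    proof (rule smooth_on_cong[OF o1])
      let ?f = "\<phi> \<circ> inv_into V \<psi>"
      have "smooth_on (\<psi> ` (V \<inter> U)) ?f"
        using M ch ch2 unfolding smooth_manifold_def by fast
      then have "smooth_on S1 ?f" by (rule smooth_on_subset) (auto simp: S1_def W_def)
      moreover have "?f ` S1 \<subseteq> T" by (auto simp: S1_def W_def inv)
      ultimately show "smooth_on S1 (\<lambda>x. g (?f x))"
        using g(1) Ck_on_compose[OF C o1] unfolding smooth_on_def by blast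
      show "g (?f x) = (chart_ext U \<phi> T g \<circ> inv_into V \<psi>) x" if "x \<in> S1" for x
        using that by (auto simp: S1_def W_def inv chart_ext_def)
    qed
    moreover have "smooth_on S2 (chart_ext U \<phi> T g \<circ> inv_into V \<psi>)"
    proof (rule smooth_on_cong[OF o2 smooth_on_const[of _ 0]])
      show "0 = (chart_ext U \<phi> T g \<circ> inv_into V \<psi>) x" if xS: "x \<in> S2" for x
      proof -
        obtain q where q: "q \<in> V" "q \<notin> L" "x = \<psi> q" using xS by (auto simp: S2_def)
        then show ?thesis
          by (cases "q \<in> U \<and> \<phi> q \<in> T") (use g(2)[of "\<phi> q"] in \<open>auto simp: inv chart_ext_def L_def\<close>)
      qed
    qed
    ultimately show ?thesis
      unfolding un smooth_on_def using Ck_on_Un[OF o1 o2] by blast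
  qed
  then show ?thesis
    by (rule smooth_funsI[rotated]) (use chart_facts(2)[OF M ch] in \<open>auto simp: chart_ext_def\<close>)
qed

section \<open>Tangent vectors and vector fields\<close>

lemma tangent_lin:
  "D \<in> tangent_space M p \<Longrightarrow> f \<in> smooth_funs M \<Longrightarrow> g \<in> smooth_funs M \<Longrightarrow>
    D (\<lambda>x. a * f x + b * g x) = a * D f + b * D g"
  by (auto simp: tangent_space_def)

lemma tangent_mult:
  "D \<in> tangent_space M p \<Longrightarrow> f \<in> smooth_funs M \<Longrightarrow> g \<in> smooth_funs M \<Longrightarrow>
    D (\<lambda>x. f x * g x) = D f * g p + f p * D g"
  by (auto simp: tangent_space_def)

lemma tangent_nonsmooth: "D \<in> tangent_space M p \<Longrightarrow> f \<notin> smooth_funs M \<Longrightarrow> D f = 0"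
  by (auto simp: tangent_space_def)

lemma tangent_zero_fun: "D \<in> tangent_space M p \<Longrightarrow> D (\<lambda>x. 0) = 0"
  using tangent_lin[OF _ smooth_funs_zero smooth_funs_zero, of D M p 0 0] by simp

lemma tangent_add:
  "D \<in> tangent_space M p \<Longrightarrow> f \<in> smooth_funs M \<Longrightarrow> g \<in> smooth_funs M \<Longrightarrow> D (\<lambda>x. f x + g x) = D f + D g"
  using tangent_lin[of D M p f g 1 1] by simp

lemma tangent_cmult:
  "D \<in> tangent_space M p \<Longrightarrow> f \<in> smooth_funs M \<Longrightarrow> D (\<lambda>x. c * f x) = c * D f"
  using tangent_lin[of D M p f f c 0] by simp

lemma tangent_sum:
  assumes "D \<in> tangent_space M p" "\<And>i. i \<in> I \<Longrightarrow> f i \<in> smooth_funs M"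
  shows "D (\<lambda>x. \<Sum>i\<in>I. f i x) = (\<Sum>i\<in>I. D (f i))"
  using assms(2)
proof (induction I rule: infinite_finite_induct)
  case (insert i I)
  then show ?case using tangent_add[OF assms(1)] smooth_funs_sum[of I f M] by simp
qed (simp_all add: tangent_zero_fun[OF assms(1)])

lemma tangent_space_combo:
  assumes "D \<in> tangent_space M p" "E \<in> tangent_space M p"
  shows "(\<lambda>f. a * D f + b * E f) \<in> tangent_space M p"
proof -
  have "a * D (\<lambda>x. f x * g x) + b * E (\<lambda>x. f x * g x) =
      (a * D f + b * E f) * g p + f p * (a * D g + b * E g)"
    if "f \<in> smooth_funs M" "g \<in> smooth_funs M" for f g
    using assms that by (simp add: tangent_mult algebra_simps)
  moreover have "a * D (\<lambda>x. c * f x + d * g x) + b * E (\<lambda>x. c * f x + d * g x) =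
      c * (a * D f + b * E f) + d * (a * D g + b * E g)"
    if "f \<in> smooth_funs M" "g \<in> smooth_funs M" for f g c d
    using assms that by (simp add: tangent_lin algebra_simps)
  ultimately show ?thesis
    using assms by (simp add: tangent_space_def)
qed

lemma zero_tangent: "(\<lambda>f. 0) \<in> tangent_space M p"
  by (simp add: tangent_space_def)

lemma vf_tangent: "X \<in> vector_fields M \<Longrightarrow> p \<in> pts M \<Longrightarrow> X p \<in> tangent_space M p"
  by (simp add: vector_fields_def)

lemma vf_outside: "X \<in> vector_fields M \<Longrightarrow> p \<notin> pts M \<Longrightarrow> X p f = 0"
  by (simp add: vector_fields_def)

lemma vf_smooth: "X \<in> vector_fields M \<Longrightarrow> f \<in> smooth_funs M \<Longrightarrow> (\<lambda>p. X p f) \<in> smooth_funs M"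
  by (simp add: vector_fields_def)

lemma vf_nonsmooth: "X \<in> vector_fields M \<Longrightarrow> f \<notin> smooth_funs M \<Longrightarrow> X p f = 0"
  by (cases "p \<in> pts M") (auto simp: vf_outside dest: vf_tangent tangent_nonsmooth)

lemma vf_zero: "(\<lambda>q g. 0) \<in> vector_fields M"
  by (simp add: vector_fields_def zero_tangent smooth_funs_zero)

lemma vf_muladd:
  assumes "f \<in> smooth_funs M" "X \<in> vector_fields M" "Y \<in> vector_fields M"
  shows "(\<lambda>q g. f q * X q g + Y q g) \<in> vector_fields M"
proof -
  have "(\<lambda>g. f q * X q g + Y q g) \<in> tangent_space M q" if "q \<in> pts M" for q
    using tangent_space_combo[OF vf_tangent[OF assms(2) that] vf_tangent[OF assms(3) that], of "f q" 1] by simp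
  then show ?thesis
    using assms by (auto simp: vector_fields_def intro!: smooth_funs_add smooth_funs_mult)
qed

lemma vf_sum:
  assumes "\<And>i. i \<in> I \<Longrightarrow> f i \<in> smooth_funs M" "\<And>i. i \<in> I \<Longrightarrow> E i \<in> vector_fields M"
  shows "(\<lambda>q g. \<Sum>i\<in>I. f i q * E i q g) \<in> vector_fields M"
  using assms
proof (induction I rule: infinite_finite_induct)
  case (insert i I)
  then show ?case using vf_muladd[of "f i" M "E i"] by simp
qed (simp_all add: vf_zero)

section \<open>Local frames and tensoriality\<close>

text \<open>The coordinate derivation in direction \<open>c\<close>, multiplied by the coefficient \<open>a\<close> and extended by 0 outside
the chart.\<close>

definition chart_field :: "('a, 'e::real_inner) manifold \<Rightarrow> 'a set \<Rightarrow> ('a \<Rightarrow> 'e) \<Rightarrow> 'e set \<Rightarrow>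
    ('e \<Rightarrow> real) \<Rightarrow> 'e \<Rightarrow> 'a vfield" where
  "chart_field M U \<phi> T a c = (\<lambda>q f. if f \<in> smooth_funs M then
     chart_ext U \<phi> T (\<lambda>x. a x * frechet_derivative (f \<circ> inv_into U \<phi>) (at x) c) q else 0)"

lemma chart_field_vf:
  fixes M :: "('a, 'e::real_inner) manifold"
  assumes M: "smooth_manifold M" and ch: "(U, \<phi>) \<in> atlas M"
    and T: "open T" "T \<subseteq> \<phi> ` U" and K: "compact K" "K \<subseteq> T"
    and a: "smooth_on T a" "\<And>x. x \<in> T \<Longrightarrow> x \<notin> K \<Longrightarrow> a x = 0"
  shows "chart_field M U \<phi> T a c \<in> vector_fields M"
proof -
  note c = chart_facts[OF M ch]
  let ?d = "\<lambda>f x. frechet_derivative (f \<circ> inv_into U \<phi>) (at x)"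
  have sm: "smooth_on (\<phi> ` U) (f \<circ> inv_into U \<phi>)" if "f \<in> smooth_funs M" for f
    using smooth_funsD[OF that ch] .
  have der: "((f \<circ> inv_into U \<phi>) has_derivative ?d f x) (at x)" if "f \<in> smooth_funs M" "x \<in> T" for f x
    using smooth_on_has_derivative[OF sm[OF that(1)]] that(2) T(2) by blast
  have "chart_field M U \<phi> T a c q \<in> tangent_space M q" for q
  proof (cases "q \<in> U \<and> \<phi> q \<in> T")
    case False
    then have "chart_field M U \<phi> T a c q = (\<lambda>f. 0)"
      by (auto simp: chart_field_def chart_ext_def)
    then show ?thesis by (simp add: zero_tangent)
  next
    case True
    then have inv: "inv_into U \<phi> (\<phi> q) = q" using c(4) by simp
    have eq: "chart_field M U \<phi> T a c q f = a (\<phi> q) * ?d f (\<phi> q) c" if "f \<in> smooth_funs M" for f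
      using True that by (simp add: chart_field_def chart_ext_def)
    have lin: "?d (\<lambda>x. k * f x + l * g x) (\<phi> q) c = k * ?d f (\<phi> q) c + l * ?d g (\<phi> q) c"
      if "f \<in> smooth_funs M" "g \<in> smooth_funs M" for f g k l
    proof -
      have "((\<lambda>x. k * (f \<circ> inv_into U \<phi>) x + l * (g \<circ> inv_into U \<phi>) x) has_derivative
          (\<lambda>v. k * ?d f (\<phi> q) v + l * ?d g (\<phi> q) v)) (at (\<phi> q))"
        using True by (intro has_derivative_add has_derivative_mult_right der that) auto
      from fun_cong[OF frechet_derivative_at[OF this, symmetric], of c]
      show ?thesis by (simp add: o_def)
    qed
    have mult: "?d (\<lambda>x. f x * g x) (\<phi> q) c = ?d f (\<phi> q) c * g q + f q * ?d g (\<phi> q) c"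
      if "f \<in> smooth_funs M" "g \<in> smooth_funs M" for f g
    proof -
      have "((\<lambda>x. (f \<circ> inv_into U \<phi>) x * (g \<circ> inv_into U \<phi>) x) has_derivative
          (\<lambda>v. (f \<circ> inv_into U \<phi>) (\<phi> q) * ?d g (\<phi> q) v + ?d f (\<phi> q) v * (g \<circ> inv_into U \<phi>) (\<phi> q))) (at (\<phi> q))"
        using True by (intro has_derivative_mult der that) auto
      from fun_cong[OF frechet_derivative_at[OF this, symmetric], of c]
      show ?thesis by (simp add: o_def inv add.commute)
    qed
    have "chart_field M U \<phi> T a c q f = 0" if "f \<notin> smooth_funs M" for f
      using that by (simp add: chart_field_def)
    then show ?thesis
      unfolding tangent_space_def
      by (auto simp: eq lin mult smooth_funs_combo smooth_funs_mult algebra_simps)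
  qed
  moreover have "chart_field M U \<phi> T a c q = (\<lambda>f. 0)" if "q \<notin> pts M" for q
    using that c(2) by (auto simp: chart_field_def chart_ext_def fun_eq_iff)
  moreover have "(\<lambda>q. chart_field M U \<phi> T a c q f) \<in> smooth_funs M" if f: "f \<in> smooth_funs M" for f
  proof -
    have "smooth_on T (\<lambda>x. a x * ?d f x c)"
      using smooth_on_subset[OF smooth_on_derivative[OF c(3) sm[OF f]] T(2)] a(1) by (intro smooth_on_mult)
    from chart_ext_smooth[OF M ch T K this] a(2) f show ?thesis by (simp add: chart_field_def)
  qed
  ultimately show ?thesis by (simp add: vector_fields_def)
qed

text \<open>Take a bump function \<open>b\<close> around \<open>p\<close> in a chart. Hadamard's lemma at a point \<open>q\<close>, multiplied by \<open>b\<^sup>2\<close>, reads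
\<open>b\<^sup>2 f - f(q) b\<^sup>2 = (\<Sum>c. (b x\<^sub>c - x\<^sub>c(q) b) (b g\<^sub>c))\<close>, an identity of global smooth functions. The first factors on the
right vanish at \<open>q\<close>, so that a derivation \<open>D\<close> at \<open>q\<close> turns it into
\<open>b(q)\<^sup>2 D f = (\<Sum>c. (D(b x\<^sub>c) - x\<^sub>c(q) D b) b(q) \<partial>\<^sub>c f(q))\<close>. Hence the frame consists, for each coordinate \<open>c\<close>, of
the function \<open>b x\<^sub>c\<close> with the field \<open>b \<partial>\<^sub>c\<close> (index \<open>(c, True)\<close>) and of \<open>- b\<close> with \<open>b x\<^sub>c \<partial>\<^sub>c\<close> (index \<open>(c, False)\<close>).
Using \<open>b x\<^sub>c\<close> and \<open>b\<close> as the functions avoids a second bump function that is constant on the support of \<open>b\<close>.\<close>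

lemma frame_at:
  fixes M :: "('a, 'e::real_inner) manifold"
  assumes M: "smooth_manifold M" and p: "p \<in> pts M"
  obtains \<rho> and I :: "('e \<times> bool) set" and h E where
    "\<rho> \<in> smooth_funs M" "\<rho> p = 1" "finite I" "\<forall>i. h i \<in> smooth_funs M" "\<forall>i. E i \<in> vector_fields M"
    "\<forall>q\<in>pts M. \<forall>D\<in>tangent_space M q. \<forall>f\<in>smooth_funs M.
       \<rho> q * \<rho> q * D f = (\<Sum>i\<in>I. D (h i) * E i q f)"
proof -
  obtain C :: "'e set" where C: "coords C" using manifold_coords[OF M] .
  have "(\<Union>(U, \<phi>)\<in>atlas M. U) = pts M" using M by (simp add: smooth_manifold_def)
  then have "p \<in> (\<Union>(U, \<phi>)\<in>atlas M. U)" using p by simp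
  then obtain U \<phi> where ch: "(U, \<phi>) \<in> atlas M" and pU: "p \<in> U" by auto
  note c = chart_facts[OF M ch]
  obtain R where R: "R > 0" "ball (\<phi> p) R \<subseteq> \<phi> ` U" using c(3) pU open_contains_ball by blast
  define T where "T = ball (\<phi> p) R"
  define K where "K = cball (\<phi> p) (R / 2)"
  have T: "open T" "T \<subseteq> \<phi> ` U" "convex T" and K: "compact K" "K \<subseteq> T"
    using R compact_cball_coords[OF C] by (auto simp: T_def K_def)
  obtain b0 :: "'e \<Rightarrow> real" where b0: "smooth_on UNIV b0" "b0 (\<phi> p) \<noteq> 0" "\<And>x. x \<notin> K \<Longrightarrow> b0 x = 0"
    using smooth_bump[of "R / 2" "\<phi> p"] R(1) unfolding K_def by auto
  define b where "b x = inverse (b0 (\<phi> p)) * b0 x" for x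
  have b: "smooth_on T b" "b (\<phi> p) = 1" "\<And>x. x \<notin> K \<Longrightarrow> b x = 0"
    using b0 smooth_on_subset[OF b0(1) subset_UNIV, of T]
    by (auto simp: b_def[abs_def] intro!: smooth_on_mult smooth_on_const)
  let ?x = "chart_ext U \<phi> T"
  \<comment> \<open>The sign of the second family belongs to the function, so that the sum is a plain one.\<close>
  define h where "h i = (if snd i then ?x (\<lambda>x. b x * (x \<bullet> fst i)) else (\<lambda>q. (-1) * ?x b q))" for i :: "'e \<times> bool"
  define E where "E i = chart_field M U \<phi> T (if snd i then b else (\<lambda>x. b x * (x \<bullet> fst i))) (fst i)" for i :: "'e \<times> bool"
  have bi: "smooth_on T (\<lambda>x. b x * (x \<bullet> c))" for c by (intro smooth_on_mult b smooth_on_inner)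
  have \<rho>: "?x b \<in> smooth_funs M" by (rule chart_ext_smooth[OF M ch T(1,2) K b(1,3)])
  have hc: "?x (\<lambda>x. b x * (x \<bullet> c)) \<in> smooth_funs M" for c
    by (rule chart_ext_smooth[OF M ch T(1,2) K bi]) (simp add: b)
  show thesis
  proof
    show "?x b \<in> smooth_funs M" by (rule \<rho>)
    show "?x b p = 1" using pU R b by (simp add: chart_ext_def T_def)
    show "finite (C \<times> (UNIV :: bool set))" using coords_finite[OF C] by simp
    show "\<forall>i. h i \<in> smooth_funs M" unfolding h_def using smooth_funs_cmult[OF \<rho>, of "-1"] hc by simp
    show "\<forall>i. E i \<in> vector_fields M"
      unfolding E_def by (rule allI, rule chart_field_vf[OF M ch T(1,2) K]) (auto simp: b bi)
    show "\<forall>q\<in>pts M. \<forall>D\<in>tangent_space M q. \<forall>f\<in>smooth_funs M.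
       ?x b q * ?x b q * D f = (\<Sum>i\<in>C \<times> UNIV. D (h i) * E i q f)"
    proof (intro ballI)
      fix q D f
      assume q: "q \<in> pts M" and D: "D \<in> tangent_space M q" and f: "f \<in> smooth_funs M"
      let ?d = "\<lambda>c. frechet_derivative (f \<circ> inv_into U \<phi>) (at (\<phi> q)) c"
      have sum: "(\<Sum>i\<in>C \<times> UNIV. D (h i) * E i q f) =
          (\<Sum>c\<in>C. D (h (c, True)) * E (c, True) q f + D (h (c, False)) * E (c, False) q f)"
        by (simp add: sum.cartesian_product' UNIV_bool add.commute)
      show "?x b q * ?x b q * D f = (\<Sum>i\<in>C \<times> UNIV. D (h i) * E i q f)"
      proof (cases "q \<in> U \<and> \<phi> q \<in> T")
        case False
        then have "?x b q = 0" "\<And>i. E i q f = 0" by (auto simp: chart_ext_def E_def chart_field_def)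
        then show ?thesis by simp
      next
        case True
        have "smooth_on T (f \<circ> inv_into U \<phi>)"
          using smooth_on_subset[OF smooth_funsD[OF f ch] T(2)] .
        then obtain g where "\<forall>c. smooth_on T (g c)"
          "\<forall>x\<in>T. (f \<circ> inv_into U \<phi>) x = (f \<circ> inv_into U \<phi>) (\<phi> q) + (\<Sum>c\<in>C. ((x - \<phi> q) \<bullet> c) * g c x)"
          "\<forall>c. g c (\<phi> q) = ?d c"
          using Hadamard[OF C T(1,3) conjunct2[OF True]] by blast
        note g = this[rule_format]
        define G where "G c = ?x (\<lambda>x. b x * g c x)" for c
        have G: "G c \<in> smooth_funs M" for c
          unfolding G_def by (rule chart_ext_smooth[OF M ch T(1,2) K]) (auto simp: b g intro!: smooth_on_mult)
        define k where "k c = (\<lambda>y. 1 * ?x (\<lambda>x. b x * (x \<bullet> c)) y + (- (\<phi> q \<bullet> c)) * ?x b y)" for c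
        have k: "k c \<in> smooth_funs M" for c unfolding k_def by (intro smooth_funs_combo hc \<rho>)
        have id: "1 * (?x b y * (?x b y * f y)) + (- f q) * (?x b y * ?x b y) = (\<Sum>c\<in>C. k c y * G c y)" for y
        proof (cases "y \<in> U \<and> \<phi> y \<in> T")
          case False
          then have "?x a y = 0" for a by (auto simp: chart_ext_def)
          then show ?thesis by (simp add: k_def)
        next
          case yT: True
          have "f y = f q + (\<Sum>c\<in>C. ((\<phi> y - \<phi> q) \<bullet> c) * g c (\<phi> y))"
            using g(2)[of "\<phi> y"] yT True c(4) by simp
          then show ?thesis
            using yT by (simp add: chart_ext_def k_def G_def inner_diff_left algebra_simps sum_distrib_left)
        qed
        have xb: "?x b q = b (\<phi> q)" using True by (simp add: chart_ext_def)
        have "D (\<lambda>y. 1 * (?x b y * (?x b y * f y)) + (- f q) * (?x b y * ?x b y)) = ?x b q * ?x b q * D f"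
          by (simp only: tangent_lin[OF D] tangent_mult[OF D] smooth_funs_mult \<rho> f) (simp add: algebra_simps)
        moreover have "D (\<lambda>y. \<Sum>c\<in>C. k c y * G c y) = (\<Sum>c\<in>C. D (k c) * G c q)"
        proof -
          have "k c q = 0" for c using True by (simp add: k_def chart_ext_def)
          then show ?thesis by (simp add: tangent_sum[OF D] tangent_mult[OF D] smooth_funs_mult k G)
        qed
        moreover have "D (k c) * G c q = D (h (c, True)) * E (c, True) q f + D (h (c, False)) * E (c, False) q f" for c
        proof -
          have "D (k c) = D (?x (\<lambda>x. b x * (x \<bullet> c))) - (\<phi> q \<bullet> c) * D (?x b)"
            unfolding k_def tangent_lin[OF D hc \<rho>] by simp
          moreover have "G c q = b (\<phi> q) * ?d c" using True g(3) by (simp add: G_def chart_ext_def)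
          moreover have "D (h (c, False)) = - D (?x b)" unfolding h_def using tangent_cmult[OF D \<rho>, of "-1"] by simp
          moreover have "h (c, True) = ?x (\<lambda>x. b x * (x \<bullet> c))" by (simp add: h_def)
          moreover have "E (c, True) q f = b (\<phi> q) * ?d c"
            "E (c, False) q f = b (\<phi> q) * (\<phi> q \<bullet> c) * ?d c"
            using True f by (simp_all add: E_def chart_field_def chart_ext_def)
          ultimately show ?thesis by (simp only:) (simp add: algebra_simps)
        qed
        ultimately show ?thesis using id sum by simp
      qed
    qed
  qed
qed

text \<open>The frame fields combined with the constant coefficients \<open>w (h i)\<close>.\<close>

lemma tangent_extends:
  fixes M :: "('a, 'e::real_inner) manifold"
  assumes M: "smooth_manifold M" and p: "p \<in> pts M" and w: "w \<in> tangent_space M p"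
  obtains X where "X \<in> vector_fields M" "X p = w"
proof -
  obtain \<rho> and I :: "('e \<times> bool) set" and h E where fr:
    "\<rho> \<in> smooth_funs M" "\<rho> p = 1" "finite I" "\<forall>i. h i \<in> smooth_funs M" "\<forall>i. E i \<in> vector_fields M"
    "\<forall>q\<in>pts M. \<forall>D\<in>tangent_space M q. \<forall>f\<in>smooth_funs M.
       \<rho> q * \<rho> q * D f = (\<Sum>i\<in>I. D (h i) * E i q f)"
    using frame_at[OF M p] .
  note fr = fr(1-3) fr(4-6)[rule_format]
  define X where "X = (\<lambda>q g. \<Sum>i\<in>I. (if q \<in> pts M then w (h i) else 0) * E i q g)"
  show thesis
  proof
    show "X \<in> vector_fields M"
      unfolding X_def by (rule vf_sum[OF smooth_funs_const[OF M] fr(5)])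
    have "X p f = w f" for f
    proof (cases "f \<in> smooth_funs M")
      case True
      then show ?thesis using fr(6)[OF p w True] p fr(2) by (simp add: X_def)
    next
      case False
      then show ?thesis using vf_nonsmooth[OF fr(5)] tangent_nonsmooth[OF w] by (simp add: X_def)
    qed
    then show "X p = w" by blast
  qed
qed

lemma extend_tangent_extends:
  assumes "smooth_manifold M" "p \<in> pts M" "w \<in> tangent_space M p"
  shows "extend_tangent M p w \<in> vector_fields M" "extend_tangent M p w p = w"
proof -
  have "\<exists>X. X \<in> vector_fields M \<and> X p = w" using tangent_extends[OF assms] by metis
  from someI_ex[OF this] show "extend_tangent M p w \<in> vector_fields M" "extend_tangent M p w p = w"
    unfolding extend_tangent_def by auto
qed

text \<open>For the difference \<open>Z\<close> of the fields, the frame gives \<open>Z = (1 - \<rho>\<^sup>2) Z + (\<Sum>i. Z(h\<^sub>i) E\<^sub>i)\<close>, in which all coefficient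
functions vanish at \<open>p\<close>.\<close>

lemma tensorial_depends_on_value:
  fixes M :: "('a, 'e::real_inner) manifold"
  assumes M: "smooth_manifold M" and p: "p \<in> pts M"
    and \<Phi>: "\<And>f X Y. f \<in> smooth_funs M \<Longrightarrow> X \<in> vector_fields M \<Longrightarrow> Y \<in> vector_fields M \<Longrightarrow>
      \<Phi> (\<lambda>q g. f q * X q g + Y q g) = f p * \<Phi> X + (\<Phi> Y :: real)"
    and X: "X \<in> vector_fields M" and Y: "Y \<in> vector_fields M" and XY: "X p = Y p"
  shows "\<Phi> X = \<Phi> Y"
proof -
  obtain \<rho> and I :: "('e \<times> bool) set" and h E where fr:
    "\<rho> \<in> smooth_funs M" "\<rho> p = 1" "finite I" "\<forall>i. h i \<in> smooth_funs M" "\<forall>i. E i \<in> vector_fields M"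
    "\<forall>q\<in>pts M. \<forall>D\<in>tangent_space M q. \<forall>f\<in>smooth_funs M.
       \<rho> q * \<rho> q * D f = (\<Sum>i\<in>I. D (h i) * E i q f)"
    using frame_at[OF M p] .
  note fr = fr(1-3) fr(4-6)[rule_format]
  have zero: "\<Phi> (\<lambda>q g. 0) = 0"
    using \<Phi>[OF smooth_funs_const[OF M, of 1] vf_zero vf_zero] p by simp
  define Z where "Z = (\<lambda>q g. (if q \<in> pts M then - 1 else 0) * Y q g + X q g)"
  have Z: "Z \<in> vector_fields M" "\<Phi> Z = \<Phi> X - \<Phi> Y"
    using vf_muladd[OF smooth_funs_const[OF M, of "-1"] Y X]
      \<Phi>[OF smooth_funs_const[OF M, of "-1"] Y X] p by (simp_all add: Z_def)
  have Zp: "Z p g = 0" for g using XY p by (simp add: Z_def)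
  define r where "r = (\<lambda>q. (if q \<in> pts M then 1 else 0) - \<rho> q * \<rho> q)"
  have r: "r \<in> smooth_funs M" unfolding r_def
    by (intro smooth_funs_diff smooth_funs_mult fr smooth_funs_const[OF M])
  define f where "f i = (\<lambda>q. Z q (h i))" for i
  have f: "f i \<in> smooth_funs M" "f i p = 0" for i
    using vf_smooth[OF Z(1) fr(4)] Zp by (simp_all add: f_def)
  have split: "Z = (\<lambda>q g. r q * Z q g + (\<Sum>i\<in>I. f i q * E i q g))"
  proof (intro ext)
    fix q g
    show "Z q g = r q * Z q g + (\<Sum>i\<in>I. f i q * E i q g)"
    proof (cases "q \<in> pts M \<and> g \<in> smooth_funs M")
      case True
      then have "(\<Sum>i\<in>I. f i q * E i q g) = \<rho> q * \<rho> q * Z q g"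
        unfolding f_def using fr(6) vf_tangent[OF Z(1)] by simp
      then show ?thesis using True by (simp add: r_def algebra_simps)
    next
      case False
      then have "Z q g = 0" "E i q g = 0" for i
        using vf_outside[OF Z(1)] vf_nonsmooth[OF Z(1)] vf_outside[OF fr(5)] vf_nonsmooth[OF fr(5)]
        by blast+
      then show ?thesis by simp
    qed
  qed
  have "\<Phi> (\<lambda>q g. \<Sum>i\<in>J. f i q * E i q g) = 0" if "finite J" for J
    using that
  proof (induction J rule: finite_induct)
    case (insert i J)
    then show ?case using \<Phi>[OF f(1) fr(5) vf_sum[where I = J, OF f(1) fr(5)], of i] f(2) by simp
  qed (simp add: zero)
  moreover have "\<Phi> Z = r p * \<Phi> Z + \<Phi> (\<lambda>q g. \<Sum>i\<in>I. f i q * E i q g)"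
    by (rule trans[OF arg_cong[where f = \<Phi>, OF split]
          \<Phi>[OF r Z(1) vf_sum[where I = I and f = f and E = E, OF f(1) fr(5)]]])
  moreover have "r p = 0" using p fr(2) by (simp add: r_def)
  ultimately have "\<Phi> Z = 0" using fr(3) by simp
  then show ?thesis using Z(2) by simp
qed

section \<open>The Lie bracket\<close>

lemma vf_lin:
  "X \<in> vector_fields M \<Longrightarrow> f \<in> smooth_funs M \<Longrightarrow> g \<in> smooth_funs M \<Longrightarrow>
    X q (\<lambda>x. a * f x + b * g x) = a * X q f + b * X q g"
  by (cases "q \<in> pts M") (auto simp: vf_outside tangent_lin[OF vf_tangent])

lemma vf_mult:
  "X \<in> vector_fields M \<Longrightarrow> f \<in> smooth_funs M \<Longrightarrow> g \<in> smooth_funs M \<Longrightarrow>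
    X q (\<lambda>x. f x * g x) = X q f * g q + f q * X q g"
  by (cases "q \<in> pts M") (auto simp: vf_outside tangent_mult[OF vf_tangent])

lemma vf_add:
  "X \<in> vector_fields M \<Longrightarrow> f \<in> smooth_funs M \<Longrightarrow> g \<in> smooth_funs M \<Longrightarrow>
    X q (\<lambda>x. f x + g x) = X q f + X q g"
  using vf_lin[of X M f g q 1 1] by simp

lemma vf_diff:
  "X \<in> vector_fields M \<Longrightarrow> f \<in> smooth_funs M \<Longrightarrow> g \<in> smooth_funs M \<Longrightarrow>
    X q (\<lambda>x. f x - g x) = X q f - X q g"
  using vf_lin[of X M f g q 1 "-1"] by simp

lemma vf_zero_fun: "X \<in> vector_fields M \<Longrightarrow> X q (\<lambda>x. 0) = 0"
  using vf_lin[OF _ smooth_funs_zero smooth_funs_zero, of X M q 0 0] by simp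

lemma vf_bracket_vector_field:
  assumes X: "X \<in> vector_fields M" and Y: "Y \<in> vector_fields M"
  shows "vf_bracket X Y \<in> vector_fields M"
proof -
  have non: "vf_bracket X Y p f = 0" if "f \<notin> smooth_funs M" for p f
    using that by (simp add: vf_bracket_def vf_nonsmooth[OF X] vf_nonsmooth[OF Y] vf_zero_fun[OF X] vf_zero_fun[OF Y])
  have lin: "vf_bracket X Y p (\<lambda>x. a * f x + b * g x) = a * vf_bracket X Y p f + b * vf_bracket X Y p g"
    if "f \<in> smooth_funs M" "g \<in> smooth_funs M" for p f g a b
    using that unfolding vf_bracket_def
    by (simp add: vf_lin[OF X] vf_lin[OF Y] vf_smooth[OF X] vf_smooth[OF Y] algebra_simps)
  have mult: "vf_bracket X Y p (\<lambda>x. f x * g x) = vf_bracket X Y p f * g p + f p * vf_bracket X Y p g"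
    if "f \<in> smooth_funs M" "g \<in> smooth_funs M" for p f g
    using that unfolding vf_bracket_def
    by (simp add: vf_mult[OF X] vf_mult[OF Y] vf_add[OF X] vf_add[OF Y] smooth_funs_mult
        vf_smooth[OF X] vf_smooth[OF Y] algebra_simps)
  have "vf_bracket X Y p \<in> tangent_space M p" for p
    unfolding tangent_space_def using non lin mult by simp
  moreover have "vf_bracket X Y p = (\<lambda>f. 0)" if "p \<notin> pts M" for p
    using that by (simp add: vf_bracket_def vf_outside[OF X] vf_outside[OF Y])
  moreover have "(\<lambda>p. vf_bracket X Y p f) \<in> smooth_funs M" if "f \<in> smooth_funs M" for f
    unfolding vf_bracket_def using that by (intro smooth_funs_diff vf_smooth[OF X] vf_smooth[OF Y])
  ultimately show ?thesis by (simp add: vector_fields_def)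
qed

lemma vf_bracket_muladd_right:
  assumes X: "X \<in> vector_fields M" and A: "A \<in> vector_fields M" and B: "B \<in> vector_fields M"
    and f: "f \<in> smooth_funs M"
  shows "vf_bracket X (\<lambda>q g. f q * A q g + B q g) p g =
    X p f * A p g + (f p * vf_bracket X A p g + vf_bracket X B p g)"
proof (cases "g \<in> smooth_funs M")
  case True
  then show ?thesis unfolding vf_bracket_def
    by (simp add: vf_add[OF X] vf_mult[OF X] smooth_funs_mult f vf_smooth[OF A] vf_smooth[OF B] algebra_simps)
next
  case False
  then show ?thesis
    using X A B by (simp add: vf_bracket_def vf_nonsmooth vf_zero_fun)
qed

lemma vf_bracket_anticomm: "vf_bracket X Y p g = - vf_bracket Y X p g"
  by (simp add: vf_bracket_def)

lemma vf_bracket_muladd_left: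
  assumes "X \<in> vector_fields M" "A \<in> vector_fields M" "B \<in> vector_fields M" "f \<in> smooth_funs M"
  shows "vf_bracket (\<lambda>q g. f q * A q g + B q g) X p g =
    - X p f * A p g + (f p * vf_bracket A X p g + vf_bracket B X p g)"
proof -
  have "vf_bracket (\<lambda>q g. f q * A q g + B q g) X p g = - vf_bracket X (\<lambda>q g. f q * A q g + B q g) p g"
    by (rule vf_bracket_anticomm)
  also have "\<dots> = - (X p f * A p g + (f p * vf_bracket X A p g + vf_bracket X B p g))"
    by (simp only: vf_bracket_muladd_right[OF assms])
  also have "\<dots> = - X p f * A p g + (f p * vf_bracket A X p g + vf_bracket B X p g)"
    by (simp only: vf_bracket_anticomm[of A X p g] vf_bracket_anticomm[of B X p g] minus_add_distrib minus_minus
        mult_minus_right mult_minus_left)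
  finally show ?thesis .
qed

lemma vf_jacobi:
  assumes X: "X \<in> vector_fields M" and Y: "Y \<in> vector_fields M" and W: "W \<in> vector_fields M"
  shows "vf_bracket (vf_bracket X Y) W p g =
    vf_bracket X (vf_bracket Y W) p g - vf_bracket Y (vf_bracket X W) p g"
proof (cases "g \<in> smooth_funs M")
  case True
  then show ?thesis unfolding vf_bracket_def
    by (simp add: vf_diff[OF X] vf_diff[OF Y] vf_diff[OF W] vf_smooth[OF X] vf_smooth[OF Y] vf_smooth[OF W])
next
  case False
  then show ?thesis
    using X Y W by (simp add: vf_bracket_def vf_nonsmooth vf_zero_fun)
qed

section \<open>Alternating forms\<close>

lemma form_outside:
  assumes "\<alpha> \<in> forms M k" "\<not> (p \<in> pts M \<and> length ws = k \<and> set ws \<subseteq> tangent_space M p)"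
  shows "\<alpha> p ws = 0"
  using assms(1)[unfolded forms_def mem_Collect_eq, THEN conjunct1, rule_format, OF assms(2)] .

lemma form_lin:
  assumes "\<alpha> \<in> forms M k" "p \<in> pts M" "length ws = k" "set ws \<subseteq> tangent_space M p" "i < k"
    "u \<in> tangent_space M p" "v \<in> tangent_space M p"
  shows "\<alpha> p (ws[i := (\<lambda>f. a * u f + b * v f)]) = a * \<alpha> p (ws[i := u]) + b * \<alpha> p (ws[i := v])"
  using assms(1)[unfolded forms_def mem_Collect_eq, THEN conjunct2, THEN conjunct1, rule_format,
      OF assms(2) conjI[OF assms(3,4)], THEN conjunct1, rule_format, OF assms(5-7)] .

lemma form_alternating:
  assumes "\<alpha> \<in> forms M k" "i < j" "j < k" "ws ! i = ws ! j"
  shows "\<alpha> p ws = 0"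
proof (cases "p \<in> pts M \<and> length ws = k \<and> set ws \<subseteq> tangent_space M p")
  case True
  then show ?thesis
    using assms(1)[unfolded forms_def mem_Collect_eq, THEN conjunct2, THEN conjunct1, rule_format,
        of p ws, THEN conjunct2, rule_format, OF _ _ assms(3,2,4)] by simp
next
  case False
  then show ?thesis by (rule form_outside[OF assms(1)])
qed

lemma form_smooth:
  assumes "\<alpha> \<in> forms M k" "length Xs = k" "set Xs \<subseteq> vector_fields M"
  shows "form_on \<alpha> Xs \<in> smooth_funs M"
  using assms(1)[unfolded forms_def mem_Collect_eq, THEN conjunct2, THEN conjunct2, rule_format,
      OF conjI[OF assms(2,3)]] .

text \<open>Polarisation: expand \<open>\<alpha>(\<dots>, u + v, \<dots>, u + v, \<dots>) = 0\<close>.\<close>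

lemma form_swap:
  assumes \<alpha>: "\<alpha> \<in> forms M k" and p: "p \<in> pts M" and ws: "length ws = k" "set ws \<subseteq> tangent_space M p"
    and ij: "i < j" "j < k" and u: "u \<in> tangent_space M p" and v: "v \<in> tangent_space M p"
  shows "\<alpha> p (ws[i := u, j := v]) = - \<alpha> p (ws[i := v, j := u])"
proof -
  define s where "s = (\<lambda>f. 1 * u f + 1 * v f)"
  have s: "s \<in> tangent_space M p" unfolding s_def by (rule tangent_space_combo[OF u v])
  have upd: "set (ws[l := x]) \<subseteq> tangent_space M p" if "x \<in> tangent_space M p" for l x
    using ws(2) that set_update_subset_insert[of ws l x] by blast
  have "\<alpha> p (ws[i := x, j := x]) = 0" for x
    using form_alternating[OF \<alpha> ij, of "ws[i := x, j := x]"] ij ws(1) by simp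
  moreover have "\<alpha> p (ws[i := s, j := s]) = \<alpha> p (ws[i := s, j := u]) + \<alpha> p (ws[i := s, j := v])"
    using form_lin[OF \<alpha> p _ upd[OF s] ij(2) u v, of i 1 1] ws(1) by (simp add: s_def)
  moreover have "\<alpha> p (ws[i := s, j := x]) = \<alpha> p (ws[i := u, j := x]) + \<alpha> p (ws[i := v, j := x])"
    if "x \<in> tangent_space M p" for x
    using form_lin[OF \<alpha> p _ upd[OF that] _ u v, of j i 1 1] ws(1) ij
    by (simp add: s_def list_update_swap[of i j])
  ultimately show ?thesis using u v by simp
qed

lemma vfs_tangent:
  "set Xs \<subseteq> vector_fields M \<Longrightarrow> p \<in> pts M \<Longrightarrow> set (map (\<lambda>X. X p) Xs) \<subseteq> tangent_space M p"
  by (auto dest: vf_tangent)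

lemma form_on_outside: "\<alpha> \<in> forms M k \<Longrightarrow> p \<notin> pts M \<Longrightarrow> form_on \<alpha> Xs p = 0"
  by (simp add: form_on_def form_outside)

lemma form_on_wrong_length: "\<alpha> \<in> forms M k \<Longrightarrow> length Xs \<noteq> k \<Longrightarrow> form_on \<alpha> Xs p = 0"
  by (simp add: form_on_def form_outside)

lemma form_on_lin:
  assumes \<alpha>: "\<alpha> \<in> forms M k" and Xs: "length Xs = k" "set Xs \<subseteq> vector_fields M" and i: "i < k"
    and X: "X \<in> vector_fields M" and Y: "Y \<in> vector_fields M"
    and Z: "\<And>g. Z p g = a * X p g + b * Y p g"
  shows "form_on \<alpha> (Xs[i := Z]) p = a * form_on \<alpha> (Xs[i := X]) p + b * form_on \<alpha> (Xs[i := Y]) p"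
proof (cases "p \<in> pts M")
  case True
  have "Z p = (\<lambda>g. a * X p g + b * Y p g)" using Z by blast
  then show ?thesis
    using form_lin[OF \<alpha> True _ vfs_tangent[OF Xs(2) True] i vf_tangent[OF X True] vf_tangent[OF Y True]] Xs(1)
    by (simp add: form_on_def map_update)
next
  case False
  then show ?thesis using form_on_outside[OF \<alpha>] by simp
qed

lemma form_on_lin_Cons:
  assumes "\<alpha> \<in> forms M k" "Suc (length Xs) = k" "set Xs \<subseteq> vector_fields M"
    "X \<in> vector_fields M" "Y \<in> vector_fields M" "\<And>g. Z p g = a * X p g + b * Y p g"
  shows "form_on \<alpha> (Z # Xs) p = a * form_on \<alpha> (X # Xs) p + b * form_on \<alpha> (Y # Xs) p"
  using form_on_lin[OF assms(1), of "X # Xs" 0 X Y Z p a b] assms by simp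

lemma form_on_swap_Cons:
  assumes \<alpha>: "\<alpha> \<in> forms M k" and Xs: "set Xs \<subseteq> vector_fields M"
    and X: "X \<in> vector_fields M" and Y: "Y \<in> vector_fields M"
  shows "form_on \<alpha> (Xs @ X # Y # Ys) p = - form_on \<alpha> (Xs @ Y # X # Ys) p"
proof (cases "p \<in> pts M \<and> length (Xs @ X # Y # Ys) = k \<and> set (map (\<lambda>X. X p) Ys) \<subseteq> tangent_space M p")
  case True
  let ?n = "length Xs" and ?ws = "map (\<lambda>X. X p) (Xs @ X # Y # Ys)"
  have "set ?ws \<subseteq> tangent_space M p"
    using True vfs_tangent[OF Xs, of p] vf_tangent[OF X] vf_tangent[OF Y] by simp
  from form_swap[OF \<alpha> _ _ this, of ?n "Suc ?n" "X p" "Y p"]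
  show ?thesis using True vf_tangent[OF X] vf_tangent[OF Y] by (simp add: form_on_def list_update_append)
next
  case False
  then have "\<not> (p \<in> pts M \<and> length (map (\<lambda>X. X p) (Xs @ A # B # Ys)) = k \<and>
      set (map (\<lambda>X. X p) (Xs @ A # B # Ys)) \<subseteq> tangent_space M p)" for A B by auto
  then have "form_on \<alpha> (Xs @ A # B # Ys) p = 0" for A B
    unfolding form_on_def by (rule form_outside[OF \<alpha>])
  then show ?thesis by simp
qed

lemma form_on_move:
  assumes \<alpha>: "\<alpha> \<in> forms M k" and X: "X \<in> vector_fields M"
  shows "set Pre \<subseteq> vector_fields M \<Longrightarrow> set Xs \<subseteq> vector_fields M \<Longrightarrow>
    form_on \<alpha> (Pre @ X # Xs @ Ys) p = (-1) ^ length Xs * form_on \<alpha> (Pre @ Xs @ X # Ys) p"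
proof (induction Xs arbitrary: Pre)
  case (Cons A Xs)
  have "form_on \<alpha> (Pre @ X # A # Xs @ Ys) p = - form_on \<alpha> (Pre @ A # X # Xs @ Ys) p"
    using form_on_swap_Cons[OF \<alpha> _ X, of Pre A "Xs @ Ys" p] Cons.prems by simp
  also have "form_on \<alpha> (Pre @ A # X # Xs @ Ys) p = (-1) ^ length Xs * form_on \<alpha> (Pre @ A # Xs @ X # Ys) p"
    using Cons.IH[of "Pre @ [A]"] Cons.prems by simp
  finally show ?case by simp
qed simp

lemma form_on_omit:
  assumes \<alpha>: "\<alpha> \<in> forms M k" and X: "X \<in> vector_fields M" and Ws: "set Ws \<subseteq> vector_fields M"
    and j: "j < length Ws"
  shows "form_on \<alpha> (X # omit j Ws) p = (-1) ^ j * form_on \<alpha> (Ws[j := X]) p"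
proof -
  have "set (take j Ws) \<subseteq> vector_fields M" using Ws set_take_subset by fast
  from form_on_move[OF \<alpha> X _ this, of "[]" "drop (Suc j) Ws" p]
  show ?thesis using j by (simp add: omit_def upd_conv_take_nth_drop)
qed

section \<open>The Lie derivative\<close>

text \<open>The terms of the Lie derivative sorted by how they depend on the argument in slot \<open>i\<close>.\<close>

lemma lie_formula_slot:
  assumes "i < length Ws"
  shows "lie_formula X \<alpha> (Ws[i := W]) p = X p (form_on \<alpha> (Ws[i := W])) -
    (form_on \<alpha> (Ws[i := vf_bracket X W]) p +
     (\<Sum>l\<in>{..<length Ws} - {i}. form_on \<alpha> ((Ws[l := vf_bracket X (Ws ! l)])[i := W]) p))"
proof -
  have "(\<Sum>l<length Ws. form_on \<alpha> ((Ws[i := W])[l := vf_bracket X (Ws[i := W] ! l)]) p) =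
      form_on \<alpha> (Ws[i := vf_bracket X W]) p +
      (\<Sum>l\<in>{..<length Ws} - {i}. form_on \<alpha> ((Ws[i := W])[l := vf_bracket X (Ws[i := W] ! l)]) p)"
    using assms by (subst sum.remove[of _ i]) auto
  also have "(\<Sum>l\<in>{..<length Ws} - {i}. form_on \<alpha> ((Ws[i := W])[l := vf_bracket X (Ws[i := W] ! l)]) p) =
      (\<Sum>l\<in>{..<length Ws} - {i}. form_on \<alpha> ((Ws[l := vf_bracket X (Ws ! l)])[i := W]) p)"
    by (rule sum.cong) (auto simp: list_update_swap)
  finally show ?thesis by (simp add: lie_formula_def)
qed

lemma set_update_vf: "set Ws \<subseteq> vector_fields M \<Longrightarrow> W \<in> vector_fields M \<Longrightarrow> set (Ws[i := W]) \<subseteq> vector_fields M"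
  using set_update_subset_insert[of Ws i W] by blast

text \<open>Replacing the argument in slot \<open>i\<close> by \<open>f A\<close> produces the extra term \<open>X(f) \<alpha>(\<dots>, A, \<dots>)\<close> twice: from
the derivative of \<open>\<alpha>(\<dots>, f A, \<dots>)\<close> and from the bracket \<open>[X, f A]\<close>. They cancel, so the formula is
tensorial in this slot.\<close>

lemma lie_formula_slot_cong:
  assumes M: "smooth_manifold M" and p: "p \<in> pts M" and \<alpha>: "\<alpha> \<in> forms M k" and X: "X \<in> vector_fields M"
    and Ws: "length Ws = k" "set Ws \<subseteq> vector_fields M" and i: "i < k"
    and W: "W \<in> vector_fields M" "W' \<in> vector_fields M" "W p = W' p"
  shows "lie_formula X \<alpha> (Ws[i := W]) p = lie_formula X \<alpha> (Ws[i := W']) p"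
proof (rule tensorial_depends_on_value[OF M p _ W])
  fix f A B
  assume f: "f \<in> smooth_funs M" and A: "A \<in> vector_fields M" and B: "B \<in> vector_fields M"
  define V where "V = (\<lambda>q g. f q * A q g + B q g)"
  \<comment> \<open>The part of \<open>[X, f A + B]\<close> in which \<open>f\<close> is not differentiated.\<close>
  define Q where "Q = (\<lambda>q g. f q * vf_bracket X A q g + vf_bracket X B q g)"
  have V: "V \<in> vector_fields M" and Q: "Q \<in> vector_fields M"
    unfolding V_def Q_def by (intro vf_muladd f A B vf_bracket_vector_field X)+
  have lin: "form_on \<alpha> (Zs[i := V]) q = f q * form_on \<alpha> (Zs[i := A]) q + form_on \<alpha> (Zs[i := B]) q"
    if "length Zs = k" "set Zs \<subseteq> vector_fields M" for Zs q
    using form_on_lin[OF \<alpha> that i A B, of V q "f q" 1] by (simp add: V_def)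
  have "form_on \<alpha> (Ws[i := V]) = (\<lambda>q. f q * form_on \<alpha> (Ws[i := A]) q + form_on \<alpha> (Ws[i := B]) q)"
    using lin[OF Ws] by blast
  moreover have sm: "form_on \<alpha> (Ws[i := A]) \<in> smooth_funs M" "form_on \<alpha> (Ws[i := B]) \<in> smooth_funs M"
    using Ws by (intro form_smooth[OF \<alpha>] set_update_vf A B; simp)+
  ultimately have 1: "X p (form_on \<alpha> (Ws[i := V])) = X p f * form_on \<alpha> (Ws[i := A]) p +
      f p * X p (form_on \<alpha> (Ws[i := A])) + X p (form_on \<alpha> (Ws[i := B]))"
    using f by (simp add: vf_add[OF X] vf_mult[OF X] smooth_funs_mult)
  have "form_on \<alpha> (Ws[i := vf_bracket X V]) p = X p f * form_on \<alpha> (Ws[i := A]) p + 1 * form_on \<alpha> (Ws[i := Q]) p"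
    by (rule form_on_lin[OF \<alpha> Ws i A Q]) (simp add: V_def Q_def vf_bracket_muladd_right[OF X A B f])
  also have "form_on \<alpha> (Ws[i := Q]) p = f p * form_on \<alpha> (Ws[i := vf_bracket X A]) p + 1 * form_on \<alpha> (Ws[i := vf_bracket X B]) p"
    by (rule form_on_lin[OF \<alpha> Ws i vf_bracket_vector_field[OF X A] vf_bracket_vector_field[OF X B]]) (simp add: Q_def)
  finally have 2: "form_on \<alpha> (Ws[i := vf_bracket X V]) p = X p f * form_on \<alpha> (Ws[i := A]) p +
     (f p * form_on \<alpha> (Ws[i := vf_bracket X A]) p + form_on \<alpha> (Ws[i := vf_bracket X B]) p)" by simp
  have 3: "(\<Sum>l\<in>{..<length Ws} - {i}. form_on \<alpha> ((Ws[l := vf_bracket X (Ws ! l)])[i := V]) p) =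
     f p * (\<Sum>l\<in>{..<length Ws} - {i}. form_on \<alpha> ((Ws[l := vf_bracket X (Ws ! l)])[i := A]) p) +
     (\<Sum>l\<in>{..<length Ws} - {i}. form_on \<alpha> ((Ws[l := vf_bracket X (Ws ! l)])[i := B]) p)"
    unfolding sum_distrib_left sum.distrib[symmetric]
  proof (rule sum.cong[OF refl], rule lin)
    fix l assume "l \<in> {..<length Ws} - {i}"
    then show "set (Ws[l := vf_bracket X (Ws ! l)]) \<subseteq> vector_fields M"
      using Ws by (intro set_update_vf vf_bracket_vector_field X) auto
  qed (use Ws in simp)
  have iw: "i < length Ws" using i Ws(1) by simp
  show "lie_formula X \<alpha> (Ws[i := (\<lambda>q g. f q * A q g + B q g)]) p =
      f p * lie_formula X \<alpha> (Ws[i := A]) p + lie_formula X \<alpha> (Ws[i := B]) p"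
    unfolding V_def[symmetric] lie_formula_slot[OF iw] 1 2 3 by (simp add: algebra_simps)
qed

text \<open>Exchange the arguments one at a time.\<close>

lemma lie_formula_cong:
  assumes M: "smooth_manifold M" and p: "p \<in> pts M" and \<alpha>: "\<alpha> \<in> forms M k" and X: "X \<in> vector_fields M"
    and Ws: "length Ws = k" "set Ws \<subseteq> vector_fields M" and Ws': "length Ws' = k" "set Ws' \<subseteq> vector_fields M"
    and eq: "map (\<lambda>W. W p) Ws = map (\<lambda>W. W p) Ws'"
  shows "lie_formula X \<alpha> Ws p = lie_formula X \<alpha> Ws' p"
proof -
  have "lie_formula X \<alpha> (take n Ws' @ drop n Ws) p = lie_formula X \<alpha> Ws p" if "n \<le> k" for n
    using that
  proof (induction n)
    case (Suc n)
    let ?L = "take n Ws' @ drop n Ws"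
    have n: "n < k" using Suc by simp
    have L: "length ?L = k" "set ?L \<subseteq> vector_fields M"
      using Ws Ws' n set_take_subset[of n Ws'] set_drop_subset[of n Ws] by auto
    have "?L = ?L[n := Ws ! n]" using n Ws Ws' by (simp add: list_update_append nth_append Cons_nth_drop_Suc[symmetric])
    moreover have "take (Suc n) Ws' @ drop (Suc n) Ws = ?L[n := Ws' ! n]"
      using n Ws Ws' by (simp add: list_update_append take_Suc_conv_app_nth Cons_nth_drop_Suc[symmetric])
    moreover have "(Ws ! n) p = (Ws' ! n) p"
      using eq n Ws(1) Ws'(1) by (metis nth_map)
    then have "lie_formula X \<alpha> (?L[n := Ws ! n]) p = lie_formula X \<alpha> (?L[n := Ws' ! n]) p"
      using n Ws Ws' by (intro lie_formula_slot_cong[OF M p \<alpha> X L n]) auto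
    ultimately show ?case using Suc by simp
  qed simp
  from this[of k] show ?thesis using Ws Ws' by simp
qed

lemma extend_tangent_list:
  assumes M: "smooth_manifold M" and p: "p \<in> pts M" and ws: "set ws \<subseteq> tangent_space M p"
  shows "set (map (extend_tangent M p) ws) \<subseteq> vector_fields M"
    "map (\<lambda>W. W p) (map (extend_tangent M p) ws) = ws"
  using extend_tangent_extends[OF M p] ws by (auto simp: map_idI subset_iff)

lemma lie_formula_wrong_length:
  assumes "\<alpha> \<in> forms M k" "X \<in> vector_fields M" "length Ws \<noteq> k"
  shows "lie_formula X \<alpha> Ws p = 0"
proof -
  have "form_on \<alpha> Ws = (\<lambda>q. 0)" using form_on_wrong_length[OF assms(1,3)] by blast
  then show ?thesis
    using assms by (simp add: lie_formula_def vf_zero_fun[OF assms(2)] form_on_wrong_length[OF assms(1)])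
qed

text \<open>This trades the chosen extensions in the definition of the Lie derivative for arbitrary global fields.\<close>

lemma lie_deriv_eq_zero_iff:
  assumes M: "smooth_manifold M" and \<alpha>: "\<alpha> \<in> forms M k" and X: "X \<in> vector_fields M"
  shows "lie_deriv M X \<alpha> = zero_form \<longleftrightarrow>
    (\<forall>Ws p. length Ws = k \<and> set Ws \<subseteq> vector_fields M \<and> p \<in> pts M \<longrightarrow> lie_formula X \<alpha> Ws p = 0)"
proof (intro iffI allI impI)
  fix Ws p assume L: "lie_deriv M X \<alpha> = zero_form"
    and *: "length Ws = k \<and> set Ws \<subseteq> vector_fields M \<and> p \<in> pts M"
  let ?ws = "map (\<lambda>W. W p) Ws"
  have ws: "set ?ws \<subseteq> tangent_space M p" by (rule vfs_tangent) (use * in simp_all)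
  note e = extend_tangent_list[OF M conjunct2[OF conjunct2[OF *]] ws]
  have "lie_formula X \<alpha> Ws p = lie_formula X \<alpha> (map (extend_tangent M p) ?ws) p"
    by (rule lie_formula_cong[OF M _ \<alpha> X]) (use * e in \<open>simp_all only: length_map\<close>)
  also have "\<dots> = lie_deriv M X \<alpha> p ?ws" using * ws by (simp only: lie_deriv_def if_True simp_thms)
  finally show "lie_formula X \<alpha> Ws p = 0" by (simp add: L zero_form_def)
next
  assume *: "\<forall>Ws p. length Ws = k \<and> set Ws \<subseteq> vector_fields M \<and> p \<in> pts M \<longrightarrow> lie_formula X \<alpha> Ws p = 0"
  have "lie_deriv M X \<alpha> p ws = 0" for p ws
  proof (cases "p \<in> pts M \<and> set ws \<subseteq> tangent_space M p")
    case True
    then have "lie_formula X \<alpha> (map (extend_tangent M p) ws) p = 0"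
      using * extend_tangent_list(1)[OF M, of p ws] lie_formula_wrong_length[OF \<alpha> X, of "map (extend_tangent M p) ws"]
      by (cases "length ws = k") simp_all
    then show ?thesis by (simp add: lie_deriv_def)
  qed (auto simp: lie_deriv_def)
  then show "lie_deriv M X \<alpha> = zero_form" by (simp add: zero_form_def fun_eq_iff)
qed

text \<open>Applying \<open>X\<close> and \<open>Y\<close> in succession to \<open>\<alpha>(W\<^sub>1, \<dots>, W\<^sub>k)\<close> gives terms in which both act on the same
argument and mixed terms. The mixed terms are symmetric in \<open>X\<close> and \<open>Y\<close> and cancel in the commutator; the others
combine to \<open>[[X, Y], W\<^sub>i]\<close> by the Jacobi identity.\<close>

lemma lie_formula_bracket:
  assumes \<alpha>: "\<alpha> \<in> forms M k" and X: "X \<in> vector_fields M" and Y: "Y \<in> vector_fields M"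
    and Ws: "length Ws = k" "set Ws \<subseteq> vector_fields M" and p: "p \<in> pts M"
    and LX: "\<And>Ws p. length Ws = k \<Longrightarrow> set Ws \<subseteq> vector_fields M \<Longrightarrow> p \<in> pts M \<Longrightarrow> lie_formula X \<alpha> Ws p = 0"
    and LY: "\<And>Ws p. length Ws = k \<Longrightarrow> set Ws \<subseteq> vector_fields M \<Longrightarrow> p \<in> pts M \<Longrightarrow> lie_formula Y \<alpha> Ws p = 0"
  shows "lie_formula (vf_bracket X Y) \<alpha> Ws p = 0"
proof -
  \<comment> \<open>The mixed terms, in which \<open>A\<close> and \<open>B\<close> act on different arguments.\<close>
  define S where "S A B = (\<Sum>i<k. \<Sum>l\<in>{..<k} - {i}. form_on \<alpha> ((Ws[l := vf_bracket A (Ws ! l)])[i := vf_bracket B (Ws ! i)]) p)" for A B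
  have W: "Ws ! i \<in> vector_fields M" if "i < k" for i using Ws that by auto
  have second: "A p (\<lambda>q. B q (form_on \<alpha> Ws)) =
      (\<Sum>i<k. form_on \<alpha> (Ws[i := vf_bracket A (vf_bracket B (Ws ! i))]) p) + S A B"
    if A: "A \<in> vector_fields M" and B: "B \<in> vector_fields M"
      and LA: "\<And>Ws p. length Ws = k \<Longrightarrow> set Ws \<subseteq> vector_fields M \<Longrightarrow> p \<in> pts M \<Longrightarrow> lie_formula A \<alpha> Ws p = 0"
      and LB: "\<And>Ws p. length Ws = k \<Longrightarrow> set Ws \<subseteq> vector_fields M \<Longrightarrow> p \<in> pts M \<Longrightarrow> lie_formula B \<alpha> Ws p = 0"
    for A B
  proof -
    have set_i: "set (Ws[i := vf_bracket B (Ws ! i)]) \<subseteq> vector_fields M" if "i < k" for i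
      using that by (intro set_update_vf Ws vf_bracket_vector_field B W)
    have "B q (form_on \<alpha> Ws) = (\<Sum>i<k. form_on \<alpha> (Ws[i := vf_bracket B (Ws ! i)]) q)" for q
    proof (cases "q \<in> pts M")
      case True
      then show ?thesis using LB[OF Ws True] Ws(1) by (simp add: lie_formula_def)
    next
      case False
      then show ?thesis using form_on_outside[OF \<alpha>] vf_outside[OF B] by simp
    qed
    then have "A p (\<lambda>q. B q (form_on \<alpha> Ws)) = A p (\<lambda>q. \<Sum>i<k. form_on \<alpha> (Ws[i := vf_bracket B (Ws ! i)]) q)"
      by simp
    also have "\<dots> = (\<Sum>i<k. A p (form_on \<alpha> (Ws[i := vf_bracket B (Ws ! i)])))"
      using Ws set_i by (intro tangent_sum[OF vf_tangent[OF A p]] form_smooth[OF \<alpha>]) auto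
    also have "\<dots> = (\<Sum>i<k. form_on \<alpha> (Ws[i := vf_bracket A (vf_bracket B (Ws ! i))]) p +
        (\<Sum>l\<in>{..<k} - {i}. form_on \<alpha> ((Ws[l := vf_bracket A (Ws ! l)])[i := vf_bracket B (Ws ! i)]) p))"
    proof (rule sum.cong[OF refl])
      fix i assume i: "i \<in> {..<k}"
      then have "lie_formula A \<alpha> (Ws[i := vf_bracket B (Ws ! i)]) p = 0"
        using Ws set_i p by (intro LA) auto
      then show "A p (form_on \<alpha> (Ws[i := vf_bracket B (Ws ! i)])) =
        form_on \<alpha> (Ws[i := vf_bracket A (vf_bracket B (Ws ! i))]) p +
        (\<Sum>l\<in>{..<k} - {i}. form_on \<alpha> ((Ws[l := vf_bracket A (Ws ! l)])[i := vf_bracket B (Ws ! i)]) p)"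
        using i Ws(1) by (simp add: lie_formula_slot)
    qed
    finally show ?thesis by (simp add: S_def sum.distrib)
  qed
  have sym: "S X Y = S Y X"
  proof -
    have "S X Y = (\<Sum>i<k. \<Sum>l<k. if l = i then 0 else form_on \<alpha> ((Ws[l := vf_bracket X (Ws ! l)])[i := vf_bracket Y (Ws ! i)]) p)"
      unfolding S_def by (intro sum.cong refl sum.mono_neutral_cong_left) auto
    also have "\<dots> = (\<Sum>l<k. \<Sum>i<k. if l = i then 0 else form_on \<alpha> ((Ws[l := vf_bracket X (Ws ! l)])[i := vf_bracket Y (Ws ! i)]) p)"
      by (rule sum.swap)
    also have "\<dots> = S Y X"
      unfolding S_def
      by (intro sum.cong refl sum.mono_neutral_cong_right) (auto simp: list_update_swap)
    finally show ?thesis .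
  qed
  have "form_on \<alpha> (Ws[i := vf_bracket (vf_bracket X Y) (Ws ! i)]) p =
     1 * form_on \<alpha> (Ws[i := vf_bracket X (vf_bracket Y (Ws ! i))]) p + (-1) *
     form_on \<alpha> (Ws[i := vf_bracket Y (vf_bracket X (Ws ! i))]) p" if "i < k" for i
    by (rule form_on_lin[OF \<alpha> Ws that]) (simp_all add: vf_bracket_vector_field X Y W that vf_jacobi[OF X Y])
  then have "(\<Sum>i<k. form_on \<alpha> (Ws[i := vf_bracket (vf_bracket X Y) (Ws ! i)]) p) =
     (\<Sum>i<k. form_on \<alpha> (Ws[i := vf_bracket X (vf_bracket Y (Ws ! i))]) p) -
     (\<Sum>i<k. form_on \<alpha> (Ws[i := vf_bracket Y (vf_bracket X (Ws ! i))]) p)"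
    by (simp add: sum_subtractf)
  moreover have "vf_bracket X Y p (form_on \<alpha> Ws) =
     (\<Sum>i<k. form_on \<alpha> (Ws[i := vf_bracket X (vf_bracket Y (Ws ! i))]) p) -
     (\<Sum>i<k. form_on \<alpha> (Ws[i := vf_bracket Y (vf_bracket X (Ws ! i))]) p)"
    using second[OF X Y LX LY] second[OF Y X LY LX] sym by (simp add: vf_bracket_def)
  ultimately show ?thesis using Ws(1) by (simp add: lie_formula_def)
qed

lemma lie_deriv_bracket:
  assumes M: "smooth_manifold M" and \<alpha>: "\<alpha> \<in> forms M k" and X: "X \<in> vector_fields M" and Y: "Y \<in> vector_fields M"
    and "lie_deriv M X \<alpha> = zero_form" "lie_deriv M Y \<alpha> = zero_form"
  shows "lie_deriv M (vf_bracket X Y) \<alpha> = zero_form"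
  using assms(5,6) lie_formula_bracket[OF \<alpha> X Y]
  unfolding lie_deriv_eq_zero_iff[OF M \<alpha> X] lie_deriv_eq_zero_iff[OF M \<alpha> Y]
    lie_deriv_eq_zero_iff[OF M \<alpha> vf_bracket_vector_field[OF X Y]] by blast

section \<open>Annihilating and preserving fields under brackets and linear combinations\<close>

lemma contract_form_on: "contract X \<alpha> = zero_form \<Longrightarrow> form_on \<alpha> (X # Ws) p = 0"
  by (simp add: form_on_def contract_def zero_form_def fun_eq_iff)

text \<open>In \<open>0 = (L\<^sub>X\<alpha>)(Y, W\<^sub>1, \<dots>)\<close> every term with \<open>Y\<close> as an argument vanishes, which leaves
\<open>\<alpha>([X, Y], W\<^sub>1, \<dots>)\<close>.\<close>

lemma contract_bracket:
  assumes M: "smooth_manifold M" and \<alpha>: "\<alpha> \<in> forms M k" and X: "X \<in> vector_fields M" and Y: "Y \<in> vector_fields M"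
    and LX: "lie_deriv M X \<alpha> = zero_form" and Y0: "contract Y \<alpha> = zero_form"
  shows "contract (vf_bracket X Y) \<alpha> = zero_form"
proof -
  have "\<alpha> p (vf_bracket X Y p # ws) = 0" for p ws
  proof (cases "p \<in> pts M \<and> Suc (length ws) = k \<and> set ws \<subseteq> tangent_space M p")
    case True
    then have p: "p \<in> pts M" and ws: "set ws \<subseteq> tangent_space M p" by simp_all
    define Ws where "Ws = map (extend_tangent M p) ws"
    note e = extend_tangent_list[OF M p ws, folded Ws_def]
    have len: "length Ws = length ws" by (simp add: Ws_def)
    have "lie_formula X \<alpha> (Y # Ws) p = 0"
      using LX p e(1) Y True len unfolding lie_deriv_eq_zero_iff[OF M \<alpha> X] by simp
    moreover have "form_on \<alpha> (Y # Ws) = (\<lambda>q. 0)" using contract_form_on[OF Y0] by blast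
    moreover have "(\<Sum>i<length (Y # Ws). form_on \<alpha> ((Y # Ws)[i := vf_bracket X ((Y # Ws) ! i)]) p) =
        form_on \<alpha> (vf_bracket X Y # Ws) p"
      by (simp add: sum.lessThan_Suc_shift contract_form_on[OF Y0] del: sum.lessThan_Suc)
    ultimately have "form_on \<alpha> (vf_bracket X Y # Ws) p = 0"
      by (simp add: lie_formula_def vf_zero_fun[OF X])
    then show ?thesis by (simp add: form_on_def e(2))
  next
    case False
    then have "\<not> (p \<in> pts M \<and> length (vf_bracket X Y p # ws) = k \<and> set (vf_bracket X Y p # ws) \<subseteq> tangent_space M p)"
      by auto
    then show ?thesis by (rule form_outside[OF \<alpha>])
  qed
  then show ?thesis by (simp add: contract_def zero_form_def)
qed

lemma contract_zero:
  assumes \<alpha>: "\<alpha> \<in> forms M k"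
  shows "contract (\<lambda>q g. 0) \<alpha> = zero_form"
proof -
  have "\<alpha> p ((\<lambda>g. 0) # ws) = 0" for p ws
  proof (cases "p \<in> pts M \<and> Suc (length ws) = k \<and> set ws \<subseteq> tangent_space M p")
    case True
    then show ?thesis
      using form_lin[OF \<alpha>, of p "(\<lambda>g. 0) # ws" 0 "\<lambda>g. 0" "\<lambda>g. 0" 0 0] zero_tangent[of M p] by simp
  next
    case False
    then have "\<not> (p \<in> pts M \<and> length ((\<lambda>g. 0) # ws) = k \<and> set ((\<lambda>g. 0) # ws) \<subseteq> tangent_space M p)"
      by auto
    then show ?thesis by (rule form_outside[OF \<alpha>])
  qed
  then show ?thesis by (simp add: contract_def zero_form_def)
qed

lemma contract_lin:
  assumes \<alpha>: "\<alpha> \<in> forms M k" and X: "X \<in> vector_fields M" and Y: "Y \<in> vector_fields M"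
    and 0: "contract X \<alpha> = zero_form" "contract Y \<alpha> = zero_form"
  shows "contract (\<lambda>q g. a * X q g + b * Y q g) \<alpha> = zero_form"
proof -
  have "\<alpha> p ((\<lambda>g. a * X p g + b * Y p g) # ws) = 0" for p ws
  proof (cases "p \<in> pts M \<and> Suc (length ws) = k \<and> set ws \<subseteq> tangent_space M p")
    case True
    then show ?thesis
      using form_lin[OF \<alpha>, of p "X p # ws" 0 "X p" "Y p" a b] vf_tangent[OF X, of p] vf_tangent[OF Y, of p]
        fun_cong[OF fun_cong[OF 0(1)], of p ws] fun_cong[OF fun_cong[OF 0(2)], of p ws]
      by (simp add: contract_def zero_form_def)
  next
    case False
    then have "\<not> (p \<in> pts M \<and> length (Z # ws) = k \<and> set (Z # ws) \<subseteq> tangent_space M p)" for Z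
      by auto
    then show ?thesis by (rule form_outside[OF \<alpha>])
  qed
  then show ?thesis by (simp add: contract_def zero_form_def)
qed

lemma vf_lincomb:
  assumes X: "X \<in> vector_fields M" and Y: "Y \<in> vector_fields M"
  shows "(\<lambda>q g. a * X q g + b * Y q g) \<in> vector_fields M"
proof -
  have "(\<lambda>g. a * X q g + b * Y q g) \<in> tangent_space M q" if "q \<in> pts M" for q
    by (rule tangent_space_combo[OF vf_tangent[OF X that] vf_tangent[OF Y that]])
  then show ?thesis
    using X Y by (auto simp: vector_fields_def intro!: smooth_funs_combo)
qed

lemma vf_bracket_lincomb_left:
  assumes X: "X \<in> vector_fields M" and Y: "Y \<in> vector_fields M" and W: "W \<in> vector_fields M"
  shows "vf_bracket (\<lambda>q g. a * X q g + b * Y q g) W p g = a * vf_bracket X W p g + b * vf_bracket Y W p g"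
proof (cases "g \<in> smooth_funs M")
  case True
  then show ?thesis unfolding vf_bracket_def
    by (simp add: vf_lin[OF W] vf_smooth[OF X] vf_smooth[OF Y] algebra_simps)
next
  case False
  then show ?thesis using X Y W by (simp add: vf_bracket_def vf_nonsmooth vf_zero_fun)
qed

lemma lie_deriv_lin:
  assumes M: "smooth_manifold M" and \<alpha>: "\<alpha> \<in> forms M k" and X: "X \<in> vector_fields M" and Y: "Y \<in> vector_fields M"
    and 0: "lie_deriv M X \<alpha> = zero_form" "lie_deriv M Y \<alpha> = zero_form"
  shows "lie_deriv M (\<lambda>q g. a * X q g + b * Y q g) \<alpha> = zero_form"
  unfolding lie_deriv_eq_zero_iff[OF M \<alpha> vf_lincomb[OF X Y]]
proof (intro allI impI)
  fix Ws p assume *: "length Ws = k \<and> set Ws \<subseteq> vector_fields M \<and> p \<in> pts M"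
  let ?Z = "\<lambda>q g. a * X q g + b * Y q g"
  have "form_on \<alpha> (Ws[i := vf_bracket ?Z (Ws ! i)]) p =
      a * form_on \<alpha> (Ws[i := vf_bracket X (Ws ! i)]) p + b * form_on \<alpha> (Ws[i := vf_bracket Y (Ws ! i)]) p"
    if i: "i < length Ws" for i
  proof -
    have W: "Ws ! i \<in> vector_fields M" using * i by auto
    show ?thesis
      by (rule form_on_lin[OF \<alpha> conjunct1[OF *] _ _ vf_bracket_vector_field[OF X W] vf_bracket_vector_field[OF Y W]])
        (use * i vf_bracket_lincomb_left[OF X Y W] in simp_all)
  qed
  then have "lie_formula ?Z \<alpha> Ws p = a * lie_formula X \<alpha> Ws p + b * lie_formula Y \<alpha> Ws p"
    by (simp add: lie_formula_def sum.distrib sum_distrib_left algebra_simps)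
  also have "\<dots> = 0"
    using 0 * unfolding lie_deriv_eq_zero_iff[OF M \<alpha> X] lie_deriv_eq_zero_iff[OF M \<alpha> Y] by simp
  finally show "lie_formula ?Z \<alpha> Ws p = 0" .
qed

section \<open>The exterior derivative along a contracted field\<close>

text \<open>The terms of the Koszul formula sorted by the role of the first field.\<close>

lemma koszul_Cons:
  "koszul \<alpha> (X # Ws) p = X p (form_on \<alpha> Ws)
     + (\<Sum>i<length Ws. (-1) ^ Suc i * (Ws ! i) p (form_on \<alpha> (X # omit i Ws)))
     + (\<Sum>j<length Ws. (-1) ^ Suc j * form_on \<alpha> (vf_bracket X (Ws ! j) # omit j Ws) p)
     + (\<Sum>j<length Ws. \<Sum>i<j. (-1) ^ (i + j) *
          form_on \<alpha> (vf_bracket (Ws ! i) (Ws ! j) # X # omit i (omit j Ws)) p)"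
  unfolding koszul_def length_Cons sum.lessThan_Suc_shift
  by (simp add: omit_def sum.distrib sum_subtractf sum_negf)

lemma set_omit: "set Ws \<subseteq> A \<Longrightarrow> set (omit i Ws) \<subseteq> A"
  unfolding omit_def using set_take_subset[of i Ws] set_drop_subset[of "Suc i" Ws] by auto

lemma length_omit: "i < length Ws \<Longrightarrow> Suc (length (omit i Ws)) = length Ws"
  by (simp add: omit_def)

text \<open>Replacing the first field by \<open>f A\<close> produces two extra terms \<open>W\<^sub>i(f) \<alpha>(A, \<dots>)\<close> for each \<open>i\<close>, from
differentiating \<open>\<alpha>(f A, \<dots>)\<close> and from the bracket \<open>[f A, W\<^sub>i]\<close>; their signs are opposite.\<close>

lemma koszul_tensorial:
  assumes M: "smooth_manifold M" and p: "p \<in> pts M" and \<alpha>: "\<alpha> \<in> forms M k"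
    and Ws: "length Ws = k" "set Ws \<subseteq> vector_fields M"
    and X: "X \<in> vector_fields M" and Y: "Y \<in> vector_fields M" and XY: "X p = Y p"
  shows "koszul \<alpha> (X # Ws) p = koszul \<alpha> (Y # Ws) p"
proof (rule tensorial_depends_on_value[OF M p _ X Y XY])
  fix f A B
  assume f: "f \<in> smooth_funs M" and A: "A \<in> vector_fields M" and B: "B \<in> vector_fields M"
  define V where "V = (\<lambda>q g. f q * A q g + B q g)"
  have V: "V \<in> vector_fields M" unfolding V_def by (intro vf_muladd f A B)
  have W: "Ws ! i \<in> vector_fields M" if "i < k" for i using Ws that by auto
  have om: "Suc (length (omit i Ws)) = k" "set (omit i Ws) \<subseteq> vector_fields M" if "i < k" for i
    using that Ws length_omit set_omit by metis+
  have t2: "(Ws ! i) p (form_on \<alpha> (V # omit i Ws)) =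
      (Ws ! i) p f * form_on \<alpha> (A # omit i Ws) p + f p * (Ws ! i) p (form_on \<alpha> (A # omit i Ws))
      + (Ws ! i) p (form_on \<alpha> (B # omit i Ws))" if i: "i < k" for i
  proof -
    have "form_on \<alpha> (V # omit i Ws) q = f q * form_on \<alpha> (A # omit i Ws) q + form_on \<alpha> (B # omit i Ws) q" for q
      using form_on_lin_Cons[OF \<alpha> om[OF i] A B, of V q "f q" 1] by (simp add: V_def)
    then have "form_on \<alpha> (V # omit i Ws) = (\<lambda>q. f q * form_on \<alpha> (A # omit i Ws) q + form_on \<alpha> (B # omit i Ws) q)"
      by blast
    moreover have "form_on \<alpha> (A # omit i Ws) \<in> smooth_funs M" "form_on \<alpha> (B # omit i Ws) \<in> smooth_funs M"
      using om[OF i] A B by (auto intro!: form_smooth[OF \<alpha>])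
    ultimately show ?thesis
      using f by (simp add: vf_add[OF W[OF i]] vf_mult[OF W[OF i]] smooth_funs_mult)
  qed
  have t3: "form_on \<alpha> (vf_bracket V (Ws ! i) # omit i Ws) p =
      - (Ws ! i) p f * form_on \<alpha> (A # omit i Ws) p +
      (f p * form_on \<alpha> (vf_bracket A (Ws ! i) # omit i Ws) p + form_on \<alpha> (vf_bracket B (Ws ! i) # omit i Ws) p)"
    if i: "i < k" for i
  proof -
    \<comment> \<open>The part of \<open>[f A + B, W\<^sub>i]\<close> in which \<open>f\<close> is not differentiated.\<close>
    define Q where "Q = (\<lambda>q g. f q * vf_bracket A (Ws ! i) q g + vf_bracket B (Ws ! i) q g)"
    note AW = vf_bracket_vector_field[OF A W[OF i]] and BW = vf_bracket_vector_field[OF B W[OF i]]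
    have Q: "Q \<in> vector_fields M" unfolding Q_def by (intro vf_muladd f AW BW)
    have "form_on \<alpha> (vf_bracket V (Ws ! i) # omit i Ws) p =
        (- (Ws ! i) p f) * form_on \<alpha> (A # omit i Ws) p + 1 * form_on \<alpha> (Q # omit i Ws) p"
      by (rule form_on_lin_Cons[OF \<alpha> om[OF i] A Q])
        (simp add: V_def Q_def vf_bracket_muladd_left[OF W[OF i] A B f])
    also have "form_on \<alpha> (Q # omit i Ws) p = f p * form_on \<alpha> (vf_bracket A (Ws ! i) # omit i Ws) p
        + 1 * form_on \<alpha> (vf_bracket B (Ws ! i) # omit i Ws) p"
      by (rule form_on_lin_Cons[OF \<alpha> om[OF i] AW BW]) (simp add: Q_def)
    finally show ?thesis by simp
  qed
  have t4: "form_on \<alpha> (vf_bracket (Ws ! i) (Ws ! j) # V # omit i (omit j Ws)) p =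
      f p * form_on \<alpha> (vf_bracket (Ws ! i) (Ws ! j) # A # omit i (omit j Ws)) p +
      form_on \<alpha> (vf_bracket (Ws ! i) (Ws ! j) # B # omit i (omit j Ws)) p"
    if ij: "i < j" "j < k" for i j
  proof -
    let ?Z = "vf_bracket (Ws ! i) (Ws ! j)"
    have Z: "?Z \<in> vector_fields M" using ij by (intro vf_bracket_vector_field W) auto
    have "length (?Z # A # omit i (omit j Ws)) = k"
      using ij om(1)[of j] length_omit[of i "omit j Ws"] by simp
    moreover have "set (?Z # A # omit i (omit j Ws)) \<subseteq> vector_fields M"
      using Z A set_omit[OF om(2)[OF ij(2)]] by simp
    ultimately show ?thesis
      using form_on_lin[OF \<alpha> _ _ _ A B, of "?Z # A # omit i (omit j Ws)" "Suc 0" V p "f p" 1] ij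
      by (simp add: V_def)
  qed
  have s23: "(\<Sum>i<k. (-1) ^ Suc i * (Ws ! i) p (form_on \<alpha> (V # omit i Ws)))
     + (\<Sum>j<k. (-1) ^ Suc j * form_on \<alpha> (vf_bracket V (Ws ! j) # omit j Ws) p) =
     f p * ((\<Sum>i<k. (-1) ^ Suc i * (Ws ! i) p (form_on \<alpha> (A # omit i Ws)))
     + (\<Sum>j<k. (-1) ^ Suc j * form_on \<alpha> (vf_bracket A (Ws ! j) # omit j Ws) p)) +
     ((\<Sum>i<k. (-1) ^ Suc i * (Ws ! i) p (form_on \<alpha> (B # omit i Ws)))
     + (\<Sum>j<k. (-1) ^ Suc j * form_on \<alpha> (vf_bracket B (Ws ! j) # omit j Ws) p))"
    unfolding sum.distrib[symmetric] sum_distrib_left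
    by (rule sum.cong[OF refl]) (simp add: t2 t3 algebra_simps)
  have s4: "(\<Sum>j<k. \<Sum>i<j. (-1) ^ (i + j) * form_on \<alpha> (vf_bracket (Ws ! i) (Ws ! j) # V # omit i (omit j Ws)) p) =
     f p * (\<Sum>j<k. \<Sum>i<j. (-1) ^ (i + j) * form_on \<alpha> (vf_bracket (Ws ! i) (Ws ! j) # A # omit i (omit j Ws)) p) +
     (\<Sum>j<k. \<Sum>i<j. (-1) ^ (i + j) * form_on \<alpha> (vf_bracket (Ws ! i) (Ws ! j) # B # omit i (omit j Ws)) p)"
    unfolding sum.distrib[symmetric] sum_distrib_left
    by (intro sum.cong[OF refl]) (simp add: t4 algebra_simps)
  have t1: "V p (form_on \<alpha> Ws) = f p * A p (form_on \<alpha> Ws) + B p (form_on \<alpha> Ws)" by (simp add: V_def)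
  show "koszul \<alpha> ((\<lambda>q g. f q * A q g + B q g) # Ws) p = f p * koszul \<alpha> (A # Ws) p + koszul \<alpha> (B # Ws) p"
    unfolding V_def[symmetric] koszul_Cons Ws(1) using t1 s23 s4 by (simp add: algebra_simps)
qed

text \<open>Cartan's formula \<open>L\<^sub>X\<alpha> = \<iota>\<^sub>X d\<alpha> + d \<iota>\<^sub>X\<alpha>\<close> in the case \<open>\<iota>\<^sub>X\<alpha> = 0\<close>: the terms with \<open>X\<close> inside \<open>\<alpha>\<close> vanish, and moving
\<open>[X, W\<^sub>j]\<close> from the front to slot \<open>j\<close> absorbs the signs of the others.\<close>

lemma koszul_eq_lie_formula:
  assumes \<alpha>: "\<alpha> \<in> forms M k" and X: "X \<in> vector_fields M" and X0: "contract X \<alpha> = zero_form"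
    and Ws: "set Ws \<subseteq> vector_fields M"
  shows "koszul \<alpha> (X # Ws) p = lie_formula X \<alpha> Ws p"
proof -
  have W: "Ws ! i \<in> vector_fields M" if "i < length Ws" for i using Ws that by auto
  have "form_on \<alpha> (X # Ys) = (\<lambda>q. 0)" for Ys using contract_form_on[OF X0] by blast
  then have "(Ws ! i) p (form_on \<alpha> (X # omit i Ws)) = 0" if "i < length Ws" for i
    using vf_zero_fun[OF W[OF that]] by simp
  moreover have "(-1) ^ Suc j * form_on \<alpha> (vf_bracket X (Ws ! j) # omit j Ws) p =
      - form_on \<alpha> (Ws[j := vf_bracket X (Ws ! j)]) p" if "j < length Ws" for j
    using form_on_omit[OF \<alpha> vf_bracket_vector_field[OF X W[OF that]] Ws that, of p] by (simp flip: power_add)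
  moreover have "form_on \<alpha> (vf_bracket (Ws ! i) (Ws ! j) # X # Ys) p = 0" if "i < j" "j < length Ws" for i j Ys
  proof -
    have Z: "vf_bracket (Ws ! i) (Ws ! j) \<in> vector_fields M" using that by (intro vf_bracket_vector_field W) auto
    show ?thesis
      using form_on_swap_Cons[OF \<alpha> _ Z X, of "[]" Ys p] contract_form_on[OF X0] by simp
  qed
  ultimately show ?thesis
    by (simp add: koszul_Cons lie_formula_def sum_negf del: power_Suc)
qed

lemma lie_deriv_eq_ext_deriv:
  assumes M: "smooth_manifold M" and \<alpha>: "\<alpha> \<in> forms M k" and X: "X \<in> vector_fields M"
    and X0: "contract X \<alpha> = zero_form"
    and p: "p \<in> pts M" and ws: "length ws = k" "set ws \<subseteq> tangent_space M p"
  shows "lie_deriv M X \<alpha> p ws = ext_deriv M \<alpha> p (X p # ws)"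
proof -
  define Ws where "Ws = map (extend_tangent M p) ws"
  note e = extend_tangent_list(1)[OF M p ws(2), folded Ws_def]
  have Xp: "X p \<in> tangent_space M p" by (rule vf_tangent[OF X p])
  note eX = extend_tangent_extends[OF M p Xp]
  have "lie_deriv M X \<alpha> p ws = lie_formula X \<alpha> Ws p" using p ws by (simp add: lie_deriv_def Ws_def)
  also have "\<dots> = koszul \<alpha> (X # Ws) p" by (rule koszul_eq_lie_formula[OF \<alpha> X X0 e, symmetric])
  also have "\<dots> = koszul \<alpha> (extend_tangent M p (X p) # Ws) p"
    by (rule koszul_tensorial[OF M p \<alpha> _ e X eX(1) eX(2)[symmetric]]) (simp add: Ws_def ws)
  also have "\<dots> = ext_deriv M \<alpha> p (X p # ws)" using p ws Xp by (simp add: ext_deriv_def Ws_def)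
  finally show ?thesis .
qed

lemma lie_deriv_wrong_args:
  assumes M: "smooth_manifold M" and \<alpha>: "\<alpha> \<in> forms M k" and X: "X \<in> vector_fields M"
    and "\<not> (p \<in> pts M \<and> length ws = k \<and> set ws \<subseteq> tangent_space M p)"
  shows "lie_deriv M X \<alpha> p ws = 0"
  using assms(4) lie_formula_wrong_length[OF \<alpha> X] by (auto simp: lie_deriv_def)

section \<open>Multicontractions\<close>

text \<open>Up to sign, \<open>X p\<close> can be exchanged with the first argument.\<close>

lemma form_member_zero:
  assumes \<alpha>: "\<alpha> \<in> forms M k" and 0: "contract X \<alpha> = zero_form" and mem: "X p \<in> set us"
  shows "\<alpha> p us = 0"
proof (cases "p \<in> pts M \<and> length us = k \<and> set us \<subseteq> tangent_space M p")
  case True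
  have hd: "\<alpha> p (X p # ws) = 0" for ws
    using fun_cong[OF fun_cong[OF 0], of p ws] by (simp add: contract_def zero_form_def)
  obtain i where i: "i < length us" "us ! i = X p" using mem by (auto simp: in_set_conv_nth)
  obtain u vs where us: "us = u # vs" using i by (cases us) auto
  show ?thesis
  proof (cases i)
    case 0
    then show ?thesis using i us hd by simp
  next
    case (Suc j)
    then have j: "j < length vs" "vs ! j = X p" using i us by auto
    have "us[0 := u, i := X p] = us" using i us Suc j by (metis list_update_id nth_Cons_0)
    moreover have "\<alpha> p (us[0 := u, i := X p]) = - \<alpha> p (us[0 := X p, i := u])"
      using form_swap[OF \<alpha>, of p us 0 i u "X p"] True i Suc us mem by auto
    moreover have "us[0 := X p, i := u] = X p # vs[j := u]" using us Suc by simp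
    ultimately show ?thesis using hd by simp
  qed
next
  case False
  then show ?thesis by (rule form_outside[OF \<alpha>])
qed

lemma fold_rel_contract:
  "fold rel_contract vs (\<alpha>, \<beta>) =
    (\<lambda>p ws. \<alpha> p (map (\<lambda>v. fst v p) vs @ ws), \<lambda>p ws. (-1) ^ length vs * \<beta> p (map (\<lambda>v. snd v p) vs @ ws))"
  by (induction vs arbitrary: \<alpha> \<beta>) (simp_all add: rel_contract_def contract_def)

section \<open>\<open>F\<close>-pairs\<close>

lemma fpairsD:
  assumes "v \<in> fpairs M N F"
  shows "fst v \<in> vector_fields N" "snd v \<in> vector_fields M"
    "\<And>p. p \<in> pts M \<Longrightarrow> push_tangent M N F (snd v p) = fst v (F p)"
  using assms unfolding fpairs_def by auto

lemma fpairsI: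
  assumes "Y \<in> vector_fields N" "X \<in> vector_fields M"
    "\<And>p. p \<in> pts M \<Longrightarrow> push_tangent M N F (X p) = Y (F p)"
  shows "(Y, X) \<in> fpairs M N F"
  using assms unfolding fpairs_def by auto

lemma fpairs_lincomb:
  assumes "v \<in> fpairs M N F" "w \<in> fpairs M N F"
  shows "(\<lambda>q g. a * fst v q g + b * fst w q g, \<lambda>p f. a * snd v p f + b * snd w p f) \<in> fpairs M N F"
proof (rule fpairsI)
  note v = fpairsD[OF assms(1)] and w = fpairsD[OF assms(2)]
  show "(\<lambda>q g. a * fst v q g + b * fst w q g) \<in> vector_fields N" by (rule vf_lincomb[OF v(1) w(1)])
  show "(\<lambda>p f. a * snd v p f + b * snd w p f) \<in> vector_fields M" by (rule vf_lincomb[OF v(2) w(2)])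
  show "push_tangent M N F (\<lambda>f. a * snd v p f + b * snd w p f) = (\<lambda>g. a * fst v (F p) g + b * fst w (F p) g)"
    if "p \<in> pts M" for p
    unfolding v(3)[OF that, symmetric] w(3)[OF that, symmetric] by (auto simp: push_tangent_def)
qed

text \<open>\<open>F\<close>-relatedness of \<open>X\<close> and \<open>Y\<close> means \<open>X(g \<circ> F) = Y(g) \<circ> F\<close> for all smooth \<open>g\<close>, and this identity can be iterated.\<close>

lemma fpairs_bracket:
  assumes "v \<in> fpairs M N F" "w \<in> fpairs M N F"
  shows "fpair_bracket v w \<in> fpairs M N F"
  unfolding fpair_bracket_def
proof (rule fpairsI)
  note v = fpairsD[OF assms(1)] and w = fpairsD[OF assms(2)]
  show N: "vf_bracket (fst v) (fst w) \<in> vector_fields N" by (rule vf_bracket_vector_field[OF v(1) w(1)])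
  show "vf_bracket (snd v) (snd w) \<in> vector_fields M" by (rule vf_bracket_vector_field[OF v(2) w(2)])
  define pb where "pb g = (\<lambda>x. if x \<in> pts M then g (F x) else (0::real))" for g
  have pull: "snd x q (pb g) = fst x (F q) g"
    if "x \<in> fpairs M N F" "g \<in> smooth_funs N" "q \<in> pts M" for x q g
    using fun_cong[OF fpairsD(3)[OF that(1,3)], of g] that(2) by (simp add: push_tangent_def pb_def)
  have pull': "(\<lambda>q. snd x q (pb g)) = pb (\<lambda>r. fst x r g)"
    if x: "x \<in> fpairs M N F" and g: "g \<in> smooth_funs N" for x g
  proof
    fix q show "snd x q (pb g) = pb (\<lambda>r. fst x r g) q"
      using pull[OF x g, of q] vf_outside[OF fpairsD(2)[OF x], of q] by (cases "q \<in> pts M") (simp_all add: pb_def[of "\<lambda>r. fst x r g"])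
  qed
  fix p assume p: "p \<in> pts M"
  show "push_tangent M N F (vf_bracket (snd v) (snd w) p) = vf_bracket (fst v) (fst w) (F p)"
  proof
    fix g
    show "push_tangent M N F (vf_bracket (snd v) (snd w) p) g = vf_bracket (fst v) (fst w) (F p) g"
    proof (cases "g \<in> smooth_funs N")
      case True
      have "push_tangent M N F (vf_bracket (snd v) (snd w) p) g = vf_bracket (snd v) (snd w) p (pb g)"
        using True by (simp add: push_tangent_def pb_def)
      also have "\<dots> = snd v p (pb (\<lambda>r. fst w r g)) - snd w p (pb (\<lambda>r. fst v r g))"
        by (simp add: vf_bracket_def pull'[OF assms(1) True] pull'[OF assms(2) True])
      also have "\<dots> = vf_bracket (fst v) (fst w) (F p) g"
        using pull[OF assms(1) vf_smooth[OF w(1) True] p] pull[OF assms(2) vf_smooth[OF v(1) True] p]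
        by (simp add: vf_bracket_def)
      finally show ?thesis .
    next
      case False
      then show ?thesis using vf_nonsmooth[OF N] by (simp add: push_tangent_def)
    qed
  qed
qed

lemma fpair_subspaceI:
  assumes "S \<noteq> {}" "\<And>v w a b. v \<in> S \<Longrightarrow> w \<in> S \<Longrightarrow>
    (\<lambda>q g. a * fst v q g + b * fst w q g, \<lambda>p f. a * snd v p f + b * snd w p f) \<in> S"
  shows "fpair_subspace S"
proof -
  obtain v where "v \<in> S" using assms(1) by blast
  then have "fpair_zero \<in> S" using assms(2)[of v v 0 0] by (simp add: fpair_zero_def)
  moreover have "fpair_add v w \<in> S" if "v \<in> S" "w \<in> S" for v w
    using assms(2)[OF that, of 1 1] by (simp add: fpair_add_def)
  moreover have "fpair_scale c v \<in> S" if "v \<in> S" for c v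
    using assms(2)[OF that that, of c 0] by (simp add: fpair_scale_def)
  ultimately show ?thesis by (simp add: fpair_subspace_def)
qed

lemma fpair_zero_mem: "fpair_zero \<in> fpairs M N F"
  unfolding fpair_zero_def by (rule fpairsI) (simp_all add: vf_zero push_tangent_def)

lemma mem_kernel_fpairs:
  "v \<in> kernel_fpairs M N F (\<alpha>, \<beta>) \<longleftrightarrow>
    v \<in> fpairs M N F \<and> contract (fst v) \<alpha> = zero_form \<and> contract (snd v) \<beta> = zero_form"
  by (auto simp: kernel_fpairs_def rel_contract_def rel_zero_def zero_form_def fun_eq_iff)

lemma mem_preserving_fpairs:
  "v \<in> preserving_fpairs M N F (\<alpha>, \<beta>) \<longleftrightarrow>
    v \<in> fpairs M N F \<and> lie_deriv N (fst v) \<alpha> = zero_form \<and> lie_deriv M (snd v) \<beta> = zero_form"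
  by (auto simp: preserving_fpairs_def rel_lie_def rel_zero_def)

text \<open>Along a field that contracts a form to 0, its Lie derivative is the contraction of its exterior derivative.
On \<open>N\<close> this is 0, and on \<open>M\<close> it is the contraction of \<open>F\<^sup>*\<alpha>\<close> with a field that is \<open>F\<close>-related to one
annihilating \<open>\<alpha>\<close>.\<close>

lemma kernel_subset_preserving:
  assumes M: "smooth_manifold M" and N: "smooth_manifold N"
    and \<alpha>: "\<alpha> \<in> forms N k" and \<beta>: "\<beta> \<in> forms M l"
    and closed: "rel_deriv M N F (\<alpha>, \<beta>) = rel_zero"
  shows "kernel_fpairs M N F (\<alpha>, \<beta>) \<subseteq> preserving_fpairs M N F (\<alpha>, \<beta>)"
proof
  fix v assume "v \<in> kernel_fpairs M N F (\<alpha>, \<beta>)"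
  then have v: "v \<in> fpairs M N F" and v\<alpha>: "contract (fst v) \<alpha> = zero_form" and v\<beta>: "contract (snd v) \<beta> = zero_form"
    by (simp_all add: mem_kernel_fpairs)
  note vD = fpairsD[OF v]
  have d\<alpha>: "ext_deriv N \<alpha> p ws = 0" and d\<beta>: "ext_deriv M \<beta> q us = pullback M N F \<alpha> q us" for p ws q us
    using closed by (simp_all add: rel_deriv_def rel_zero_def zero_form_def fun_eq_iff)
  have "lie_deriv N (fst v) \<alpha> p ws = 0" for p ws
    using lie_deriv_wrong_args[OF N \<alpha> vD(1)] lie_deriv_eq_ext_deriv[OF N \<alpha> vD(1) v\<alpha>] d\<alpha> by metis
  moreover have "lie_deriv M (snd v) \<beta> p ws = 0" for p ws
  proof (cases "p \<in> pts M \<and> length ws = l \<and> set ws \<subseteq> tangent_space M p")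
    case True
    then have "lie_deriv M (snd v) \<beta> p ws = pullback M N F \<alpha> p (snd v p # ws)"
      using lie_deriv_eq_ext_deriv[OF M \<beta> vD(2) v\<beta>] d\<beta> by simp
    also have "\<dots> = contract (fst v) \<alpha> (F p) (map (push_tangent M N F) ws)"
      using True vf_tangent[OF vD(2), of p] vD(3)[of p] by (simp add: pullback_def contract_def)
    also have "\<dots> = 0" using v\<alpha> by (simp add: zero_form_def)
    finally show ?thesis .
  next
    case False
    then show ?thesis by (rule lie_deriv_wrong_args[OF M \<beta> vD(2)])
  qed
  ultimately show "v \<in> preserving_fpairs M N F (\<alpha>, \<beta>)"
    using v by (simp add: mem_preserving_fpairs zero_form_def fun_eq_iff)
qed

theorem proposition9p6:
  fixes M :: "('a, 'e::real_inner) manifold"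
    and N :: "('b, 'f::real_inner) manifold"
    and F :: "'a \<Rightarrow> 'b"
    and n :: nat
    and \<omega> :: "('a, 'b) rel_form"
  assumes "n \<ge> 1"
    and "smooth_manifold M" and "smooth_manifold N" and "smooth_map M N F"
    and "\<omega> \<in> rel_forms M N (n + 1)"
    and "rel_deriv M N F \<omega> = rel_zero"
  shows "kernel_fpairs M N F \<omega> \<subseteq> preserving_fpairs M N F \<omega> \<and>
    lie_ideal M N F (kernel_fpairs M N F \<omega>) (preserving_fpairs M N F \<omega>) \<and>
    (\<forall>vs. set vs \<subseteq> fpairs M N F \<and> (\<exists>v\<in>set vs. v \<in> kernel_fpairs M N F \<omega>) \<longrightarrow>
       multicontract vs \<omega> = rel_zero)"
proof -
  note M = \<open>smooth_manifold M\<close> and N = \<open>smooth_manifold N\<close>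
  obtain \<alpha> \<beta> where \<omega>: "\<omega> = (\<alpha>, \<beta>)" by (cases \<omega>)
  have \<alpha>: "\<alpha> \<in> forms N (n + 1)" and \<beta>: "\<beta> \<in> forms M n"
    using assms(5) by (simp_all add: \<omega> rel_forms_def)
  let ?K = "kernel_fpairs M N F \<omega>" and ?L = "preserving_fpairs M N F \<omega>"
  have sub: "?K \<subseteq> ?L"
    using kernel_subset_preserving[OF M N \<alpha> \<beta>] assms(6) by (simp add: \<omega>)
  have K0: "fpair_zero \<in> ?K"
    using fpair_zero_mem contract_zero[OF \<alpha>] contract_zero[OF \<beta>]
    by (simp add: \<omega> mem_kernel_fpairs fpair_zero_def)
  have subK: "fpair_subspace ?K"
  proof (rule fpair_subspaceI)
    show "?K \<noteq> {}" using K0 by blast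
    fix v w a b assume "v \<in> ?K" "w \<in> ?K"
    then have *: "v \<in> fpairs M N F" "contract (fst v) \<alpha> = zero_form" "contract (snd v) \<beta> = zero_form"
      "w \<in> fpairs M N F" "contract (fst w) \<alpha> = zero_form" "contract (snd w) \<beta> = zero_form"
      by (simp_all add: \<omega> mem_kernel_fpairs)
    note v = fpairsD[OF *(1)] and w = fpairsD[OF *(4)]
    show "(\<lambda>q g. a * fst v q g + b * fst w q g, \<lambda>p f. a * snd v p f + b * snd w p f) \<in> ?K"
      unfolding \<omega> mem_kernel_fpairs fst_conv snd_conv
      using fpairs_lincomb[OF *(1,4)] contract_lin[OF \<alpha> v(1) w(1) *(2,5)]
        contract_lin[OF \<beta> v(2) w(2) *(3,6)] by (intro conjI)
  qed
  have subL: "fpair_subspace ?L"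
  proof (rule fpair_subspaceI)
    show "?L \<noteq> {}" using K0 sub by blast
    fix v w a b assume "v \<in> ?L" "w \<in> ?L"
    then have *: "v \<in> fpairs M N F" "lie_deriv N (fst v) \<alpha> = zero_form" "lie_deriv M (snd v) \<beta> = zero_form"
      "w \<in> fpairs M N F" "lie_deriv N (fst w) \<alpha> = zero_form" "lie_deriv M (snd w) \<beta> = zero_form"
      by (simp_all add: \<omega> mem_preserving_fpairs)
    note v = fpairsD[OF *(1)] and w = fpairsD[OF *(4)]
    show "(\<lambda>q g. a * fst v q g + b * fst w q g, \<lambda>p f. a * snd v p f + b * snd w p f) \<in> ?L"
      unfolding \<omega> mem_preserving_fpairs fst_conv snd_conv
      using fpairs_lincomb[OF *(1,4)] lie_deriv_lin[OF N \<alpha> v(1) w(1) *(2,5)]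
        lie_deriv_lin[OF M \<beta> v(2) w(2) *(3,6)] by (intro conjI)
  qed
  have brL: "fpair_bracket v w \<in> ?L" if "v \<in> ?L" "w \<in> ?L" for v w
  proof -
    from that have *: "v \<in> fpairs M N F" "lie_deriv N (fst v) \<alpha> = zero_form" "lie_deriv M (snd v) \<beta> = zero_form"
      "w \<in> fpairs M N F" "lie_deriv N (fst w) \<alpha> = zero_form" "lie_deriv M (snd w) \<beta> = zero_form"
      by (simp_all add: \<omega> mem_preserving_fpairs)
    note v = fpairsD[OF *(1)] and w = fpairsD[OF *(4)]
    show ?thesis
      using fpairs_bracket[OF *(1,4)] lie_deriv_bracket[OF N \<alpha> v(1) w(1) *(2,5)]
        lie_deriv_bracket[OF M \<beta> v(2) w(2) *(3,6)]
      by (simp add: \<omega> mem_preserving_fpairs fpair_bracket_def)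
  qed
  have brK: "fpair_bracket v w \<in> ?K" if "v \<in> ?L" "w \<in> ?K" for v w
  proof -
    from that have *: "v \<in> fpairs M N F" "lie_deriv N (fst v) \<alpha> = zero_form" "lie_deriv M (snd v) \<beta> = zero_form"
      "w \<in> fpairs M N F" "contract (fst w) \<alpha> = zero_form" "contract (snd w) \<beta> = zero_form"
      by (simp_all add: \<omega> mem_preserving_fpairs mem_kernel_fpairs)
    note v = fpairsD[OF *(1)] and w = fpairsD[OF *(4)]
    show ?thesis
      using fpairs_bracket[OF *(1,4)] contract_bracket[OF N \<alpha> v(1) w(1) *(2,5)]
        contract_bracket[OF M \<beta> v(2) w(2) *(3,6)]
      by (simp add: \<omega> mem_kernel_fpairs fpair_bracket_def)
  qed
  have "?L \<subseteq> fpairs M N F" by (auto simp: preserving_fpairs_def)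
  then have ideal: "lie_ideal M N F ?K ?L"
    unfolding lie_ideal_def lie_subalgebra_def using sub subK subL brL brK by blast
  have "multicontract vs \<omega> = rel_zero" if "v \<in> set vs" "v \<in> ?K" for vs v
  proof -
    have v: "contract (fst v) \<alpha> = zero_form" "contract (snd v) \<beta> = zero_form"
      using that(2) by (simp_all add: \<omega> mem_kernel_fpairs)
    have "\<alpha> p (map (\<lambda>v. fst v p) vs @ ws) = 0" for p ws
      using that(1) by (intro form_member_zero[OF \<alpha> v(1)]) auto
    moreover have "\<beta> p (map (\<lambda>v. snd v p) vs @ ws) = 0" for p ws
      using that(1) by (intro form_member_zero[OF \<beta> v(2)]) auto
    ultimately show ?thesis
      by (simp add: multicontract_def \<omega> fold_rel_contract rel_zero_def zero_form_def)
  qed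
  then show ?thesis using sub ideal by blast
qed

end
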